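(* (1) There exists a unique linear operator $\tilde D:\Lambda\to\Lambda$ such that $D_{n+1,n}f_n=\frac1{n+1}(\tilde Df)_{n+1}$ for all $n=0,1,\dots$ and all $f\in\Lambda$; in the basis $\{FS_\mu\}$ it is given by $\tilde D\,FS_\mu=(p_1-|\mu|)FS_\mu$, $\mu\in\mathbb Y$. (2) There exists a unique linear operator $\tilde U:\Lambda\to\Lambda$ (depending on $z,z'$) such that $U_{n,n+1}f_{n+1}=\frac1{zz'+n}(\tilde Uf)_n$ for all $n=0,1,\dots$ and all $f\in\Lambda$; in the basis $\{FS_\mu\}$ it is given by $$\tilde U\,FS_\mu=\sum_{\mu_\bullet\nearrow\mu}(z)_{\mu/\mu_\bullet}(z')_{\mu/\mu_\bullet}FS_{\mu_\bullet}+(p_1+zz'+|\mu|)FS_\mu,\qquad\mu\in\mathbb Y.$$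
   Context: $\mathbb Y$ is the set of all Young diagrams (including the empty one $\varnothing$), $\mathbb Y_n$ those with $n$ boxes, $|\lambda|$ the number of boxes. $\mu\nearrow\lambda$ (equivalently $\lambda\searrow\mu$) means $\mu\subset\lambda$ and $|\lambda|=|\mu|+1$. For a skew diagram $\theta$ and $z\in\mathbb C$, $(z)_\theta=\prod_{(i,j)\in\theta}(z+j-i)$ (product over boxes, $(i,j)$ = row $i$, column $j$). $\dim\lambda$ is the number of standard Young tableaux of shape $\lambda$ ($\dim\varnothing=1$), and $\dim(\mu,\lambda)$ is the number of chains $\mu\nearrow\cdots\nearrow\lambda$ (zero unless $\mu\subseteq\lambda$; $1$ if $\mu=\lambda$). Modified Frobenius coordinates: $\lambda=(a_1,\dots,a_d\mid b_1,\dots,b_d)$ with $d$ the number of diagonal boxes, $a_i=\lambda_i-i+\frac12$, $b_i=\lambda'_i-i+\frac12$ ($\lambda_i$, $\lambda'_i$ row and column lengths). $(z,z')$ is fixed in the principal series ($z\notin\mathbb R$, $z'=\bar z$) or complementary series ($z,z'\in(N,N+1)$ for some $N\in\mathbb Z$); then $zz'>0$. Down transition: $p^\downarrow(\nu,\lambda)=\dim\lambda/\dim\nu$ if $\lambda\nearrow\nu$, else $0$. Up transition: for $\lambda\in\mathbb Y_n$, $p^\uparrow(\lambda,\nu)=\frac{(z)_{\nu/\lambda}(z')_{\nu/\lambda}}{zz'+n}\frac{\dim\nu}{(n+1)\dim\lambda}$ if $\nu\searrow\lambda$, else 0. $C(\mathbb Y_n)$ is the space of real functions on $\mathbb Y_n$;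 $D_{n+1,n}:C(\mathbb Y_n)\to C(\mathbb Y_{n+1})$, $(D_{n+1,n}f)(\nu)=\sum_{\lambda\in\mathbb Y_n}p^\downarrow(\nu,\lambda)f(\lambda)$; $U_{n,n+1}:C(\mathbb Y_{n+1})\to C(\mathbb Y_n)$, $(U_{n,n+1}g)(\lambda)=\sum_{\nu\in\mathbb Y_{n+1}}p^\uparrow(\lambda,\nu)g(\nu)$. $\Lambda=\mathbb R[p_1,p_2,\dots]$ is the algebra of symmetric functions (power sums $p_k$, Schur functions $s_\mu$), embedded injectively into the algebra of real functions on $\mathbb Y$ by $p_k(\lambda)=\sum_{i=1}^da_i^k+(-1)^{k-1}\sum_{i=1}^db_i^k$ (so $p_1(\lambda)=|\lambda|$). For $f\in\Lambda$, $f_n$ is the restriction of the function $f(\cdot)$ to $\mathbb Y_n$. The Frobenius–Schur functions $FS_\mu\in\Lambda$ ($\mu\in\mathbb Y$) are the elements with $FS_\mu(\lambda)=n^{\downarrow m}\frac{\dim(\mu,\lambda)}{\dim\lambda}$ for all $\lambda$, where $n=|\lambda|$, $m=|\mu|$, $n^{\downarrow m}=n(n-1)\cdots(n-m+1)$; $FS_\mu-s_\mu$ has degree $<|\mu|$, and $\{FS_\mu\}$ is a basis of $\Lambda$. *)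

theory Defs
  imports Complex_Main
begin

definition young :: "nat list \<Rightarrow> bool" where
  "young l \<longleftrightarrow> sorted_wrt (\<ge>) l \<and> 0 \<notin> set l"

definition Ydiag :: "nat \<Rightarrow> nat list set" where
  "Ydiag n = {l. young l \<and> sum_list l = n}"

definition boxes :: "nat list \<Rightarrow> (nat \<times> nat) set" where
  "boxes l = {(i, j). 1 \<le> i \<and> i \<le> length l \<and> 1 \<le> j \<and> j \<le> l ! (i - 1)}"

definition covers :: "nat list \<Rightarrow> nat list \<Rightarrow> bool" (infix "\<nearrow>" 50) where
  "mu \<nearrow> lam \<longleftrightarrow> young mu \<and> young lam \<and> boxes mu \<subseteq> boxes lam \<and>
     sum_list lam = sum_list mu + 1"

definition skew_poch :: "complex \<Rightarrow> nat list \<Rightarrow> nat list \<Rightarrow> complex" where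
  "skew_poch z lam mu = (\<Prod>(i, j)\<in>boxes lam - boxes mu. z + of_int (int j - int i))"

definition chains :: "nat list \<Rightarrow> nat list \<Rightarrow> nat list list set" where
  "chains mu lam = {xs. xs \<noteq> [] \<and> hd xs = mu \<and> last xs = lam \<and> (\<forall>x\<in>set xs. young x) \<and>
      (\<forall>i. Suc i < length xs \<longrightarrow> xs ! i \<nearrow> xs ! Suc i)}"

definition dimr :: "nat list \<Rightarrow> nat list \<Rightarrow> nat" where
  "dimr mu lam = card (chains mu lam)"

definition dimY :: "nat list \<Rightarrow> nat" where
  "dimY lam = dimr [] lam"

definition conj_len :: "nat list \<Rightarrow> nat \<Rightarrow> nat" where
  "conj_len l j = length (filter (\<lambda>x. j \<le> x) l)"

definition diag_len :: "nat list \<Rightarrow> nat" where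
  "diag_len l = card {i. 1 \<le> i \<and> i \<le> length l \<and> i \<le> l ! (i - 1)}"

definition frob_a :: "nat list \<Rightarrow> nat \<Rightarrow> real" where
  "frob_a l i = real (l ! (i - 1)) - real i + 1/2"

definition frob_b :: "nat list \<Rightarrow> nat \<Rightarrow> real" where
  "frob_b l i = real (conj_len l i) - real i + 1/2"

definition psum :: "nat \<Rightarrow> nat list \<Rightarrow> real" where
  "psum k l = (\<Sum>i=1..diag_len l. frob_a l i ^ k + (-1) ^ (k - 1) * frob_b l i ^ k)"

section \<open>The algebra Lambda, realised as its (injective) image in functions on Y\<close>

inductive_set Lam :: "(nat list \<Rightarrow> real) set" where
  const: "(\<lambda>l. if young l then c else 0) \<in> Lam"
| gen: "1 \<le> k \<Longrightarrow> (\<lambda>l. if young l then psum k l else 0) \<in> Lam"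
| add: "f \<in> Lam \<Longrightarrow> g \<in> Lam \<Longrightarrow> (\<lambda>l. f l + g l) \<in> Lam"
| mult: "f \<in> Lam \<Longrightarrow> g \<in> Lam \<Longrightarrow> (\<lambda>l. f l * g l) \<in> Lam"

definition lin_op_Lam :: "((nat list \<Rightarrow> real) \<Rightarrow> (nat list \<Rightarrow> real)) \<Rightarrow> bool" where
  "lin_op_Lam T \<longleftrightarrow> (\<forall>f\<in>Lam. T f \<in> Lam) \<and>
     (\<forall>f\<in>Lam. \<forall>g\<in>Lam. T (\<lambda>l. f l + g l) = (\<lambda>l. T f l + T g l)) \<and>
     (\<forall>f\<in>Lam. \<forall>c::real. T (\<lambda>l. c * f l) = (\<lambda>l. c * T f l))"

definition falling :: "nat \<Rightarrow> nat \<Rightarrow> real" where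
  "falling n m = (\<Prod>i<m. real n - real i)"

definition FS :: "nat list \<Rightarrow> nat list \<Rightarrow> real" where
  "FS mu = (\<lambda>lam. if young lam then
      falling (sum_list lam) (sum_list mu) * real (dimr mu lam) / real (dimY lam) else 0)"

definition pdown :: "nat list \<Rightarrow> nat list \<Rightarrow> real" where
  "pdown nu lam = (if lam \<nearrow> nu then real (dimY lam) / real (dimY nu) else 0)"

definition pup :: "complex \<Rightarrow> complex \<Rightarrow> nat list \<Rightarrow> nat list \<Rightarrow> real" where
  "pup z z' lam nu = (if lam \<nearrow> nu then
      Re (skew_poch z nu lam * skew_poch z' nu lam) / (Re (z * z') + real (sum_list lam))
      * real (dimY nu) / ((real (sum_list lam) + 1) * real (dimY lam))
    else 0)"

definition Dop :: "nat \<Rightarrow> (nat list \<Rightarrow> real) \<Rightarrow> nat list \<Rightarrow> real" where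
  "Dop n f nu = (\<Sum>lam\<in>Ydiag n. pdown nu lam * f lam)"

definition Uop :: "complex \<Rightarrow> complex \<Rightarrow> nat \<Rightarrow> (nat list \<Rightarrow> real) \<Rightarrow> nat list \<Rightarrow> real" where
  "Uop z z' n g lam = (\<Sum>nu\<in>Ydiag (Suc n). pup z z' lam nu * g nu)"

text \<open>Principal or complementary series.\<close>
definition admissible :: "complex \<Rightarrow> complex \<Rightarrow> bool" where
  "admissible z z' \<longleftrightarrow> (Im z \<noteq> 0 \<and> z' = cnj z) \<or>
     (\<exists>N::int. Im z = 0 \<and> Im z' = 0 \<and> of_int N < Re z \<and> Re z < of_int N + 1 \<and>
        of_int N < Re z' \<and> Re z' < of_int N + 1)"

end

theory Submission
  imports
    Defs
    "HOL-Computational_Algebra.Polynomial"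
    "HOL-Computational_Algebra.Formal_Power_Series"
begin

text \<open>Off the empty diagram both operators are forced by the intertwining relations; what has to be
  shown is that they preserve \<open>Lam\<close>. Adding or removing a box of content \<open>c\<close> changes an element of
  \<open>Lam\<close> by a polynomial in \<open>c\<close> with coefficients in \<open>Lam\<close>, so it suffices that the moments of the
  contents under the weights \<open>dim(nu) / ((n + 1) dim(lam))\<close> and \<open>n dim(rho) / dim(lam)\<close> lie in \<open>Lam\<close>.
  By Frobenius' dimension formula these weights are, up to sign, the residues of a rational function
  and of its inverse, whose zeros and poles are the contents of the removable and the addable boxes.
  The logarithmic derivative of that function has power sums of contents as coefficients, and Newton's
  recursion then puts the moments into \<open>Lam\<close>.

  The formulas on the Frobenius-Schur functions reduce to an identity for numbers of chains. It follows
  by induction from the commutation of adding and removing a box: if additions are weighted by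
  \<open>(z + c) (z' + c)\<close>, the commutator is multiplication by \<open>z z' + 2 n\<close>.\<close>

section \<open>Partial fractions and Newton's recursion\<close>

definition lin_factor :: "'a::field \<Rightarrow> 'a fps" where
  "lin_factor a = 1 - fps_const a * fps_X"

lemma lin_factor_nth_0 [simp]: "fps_nth (lin_factor a) 0 = 1"
  by (simp add: lin_factor_def)

lemma lin_factor_diff: "lin_factor a - lin_factor b = fps_const (b - a) * fps_X"
  by (simp add: lin_factor_def algebra_simps flip: fps_const_sub)

lemma lin_factor_mult_nth_Suc:
  "fps_nth (lin_factor a * F) (Suc n) = fps_nth F (Suc n) - a * fps_nth F n"
  by (simp add: lin_factor_def left_diff_distrib mult.assoc)

lemma inverse_lin_factor_nth [simp]: "fps_nth (inverse (lin_factor a)) n = a ^ n"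
proof -
  have "lin_factor a * Abs_fps (\<lambda>n. a ^ n) = 1"
  proof (rule fps_ext)
    fix n show "fps_nth (lin_factor a * Abs_fps (\<lambda>n. a ^ n)) n = fps_nth 1 n"
      by (cases n) (simp_all add: lin_factor_mult_nth_Suc)
  qed
  then have "inverse (lin_factor a) = Abs_fps (\<lambda>n. a ^ n)"
    by (rule fps_inverse_unique)
  then show ?thesis by simp
qed

lemma prod_lin_factor_nth_0 [simp]: "fps_nth (\<Prod>i\<in>A. lin_factor (x i)) 0 = 1"
  by (induction A rule: infinite_finite_induct) simp_all

lemma prod_lin_factor_nonzero: "(\<Prod>i\<in>A. lin_factor (x i)) \<noteq> 0"
  using prod_lin_factor_nth_0[of x A] by (metis fps_zero_nth zero_neq_one)

lemma prod_lin_factor_mult_inverse_nth: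
  assumes "finite J"
  shows "fps_nth ((\<Prod>j\<in>J. lin_factor (y j)) * inverse (lin_factor v)) (k + card J)
    = v ^ k * (\<Prod>j\<in>J. v - y j)"
  using assms
proof (induction J arbitrary: k rule: finite_induct)
  case (insert a J)
  let ?F = "(\<Prod>j\<in>J. lin_factor (y j)) * inverse (lin_factor v)"
  have "fps_nth (lin_factor (y a) * ?F) (Suc (k + card J))
      = fps_nth ?F (Suc k + card J) - y a * fps_nth ?F (k + card J)"
    by (simp add: lin_factor_mult_nth_Suc)
  also have "\<dots> = v ^ k * ((v - y a) * (\<Prod>j\<in>J. v - y j))"
    unfolding insert.IH by (simp add: algebra_simps)
  finally show ?case using insert.hyps by (simp add: mult.assoc)
qed simp

definition divided_difference :: "('i \<Rightarrow> 'a::field) \<Rightarrow> ('i \<Rightarrow> 'a fps) \<Rightarrow> 'i set \<Rightarrow> 'a fps" where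
  "divided_difference v g I = (\<Sum>i\<in>I. fps_const (inverse (\<Prod>j\<in>I - {i}. v i - v j)) * g i)"

lemma divided_difference_remove:
  assumes "finite I" "inj_on v I" "d \<in> I"
  shows "divided_difference v g (I - {d})
    = (\<Sum>i\<in>I. fps_const ((v i - v d) * inverse (\<Prod>j\<in>I - {i}. v i - v j)) * g i)"
proof -
  have "inverse (\<Prod>j\<in>I - {d} - {i}. v i - v j) = (v i - v d) * inverse (\<Prod>j\<in>I - {i}. v i - v j)"
    if i: "i \<in> I - {d}" for i
  proof -
    have "(\<Prod>j\<in>I - {i}. v i - v j) = (v i - v d) * (\<Prod>j\<in>I - {d} - {i}. v i - v j)"
      using assms(1,3) i prod.remove[of "I - {i}" d "\<lambda>j. v i - v j"]
      by (auto simp: Diff_insert2[symmetric] insert_commute)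
    moreover have "v i \<noteq> v d" using inj_onD[OF assms(2)] assms(3) i by blast
    ultimately show ?thesis by simp
  qed
  then show ?thesis
    unfolding divided_difference_def by (subst sum.remove[OF assms(1,3)]) simp
qed

lemma divided_difference_recursion:
  assumes "finite I" "inj_on v I" "a \<in> I" "b \<in> I"
  shows "divided_difference v g (I - {a}) - divided_difference v g (I - {b})
    = fps_const (v b - v a) * divided_difference v g I"
proof -
  have "fps_const ((v i - v a) * c) * g i - fps_const ((v i - v b) * c) * g i
      = fps_const (v b - v a) * (fps_const c * g i)" for i c
  proof -
    have "(v i - v a) * c - (v i - v b) * c = (v b - v a) * c"
      by (simp flip: left_diff_distrib)
    then show ?thesis by (simp flip: left_diff_distrib mult.assoc)
  qed
  then show ?thesis
    unfolding divided_difference_remove[OF assms(1,2,3)] divided_difference_remove[OF assms(1,2,4)]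
    by (simp only: divided_difference_def sum_subtractf[symmetric] sum_distrib_left)
qed

lemma divided_difference_inverse_lin_factor:
  assumes "finite I" "I \<noteq> {}" "inj_on v I"
  shows "divided_difference v (\<lambda>i. inverse (lin_factor (v i))) I * (\<Prod>i\<in>I. lin_factor (v i))
    = fps_X ^ (card I - 1)"
  using assms
proof (induction "card I" arbitrary: I rule: less_induct)
  case less
  let ?R = "divided_difference v (\<lambda>i. inverse (lin_factor (v i)))"
  let ?Q = "\<lambda>I. \<Prod>i\<in>I. lin_factor (v i)"
  obtain a where a: "a \<in> I" using less.prems by blast
  show ?case
  proof (cases "I = {a}")
    case True
    then show ?thesis by (simp add: divided_difference_def inverse_mult_eq_1)
  next
    case False
    then obtain b where b: "b \<in> I" "b \<noteq> a" using a by blast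
    have remove: "?R (I - {d}) * ?Q I = fps_X ^ (card I - 2) * lin_factor (v d)" if d: "d \<in> I" for d
    proof -
      have "I - {d} \<noteq> {}" using a b by blast
      then have "?R (I - {d}) * ?Q (I - {d}) = fps_X ^ (card (I - {d}) - 1)"
        using less.hyps[OF card_Diff1_less[OF less.prems(1) d]] less.prems
        by (simp add: inj_on_diff)
      moreover have "?Q I = lin_factor (v d) * ?Q (I - {d})"
        by (rule prod.remove[OF less.prems(1) d])
      moreover have "card (I - {d}) - 1 = card I - 2"
        using d by (simp add: card_Diff_singleton)
      ultimately show ?thesis by (simp add: mult_ac)
    qed
    have "fps_const (v b - v a) * (?R I * ?Q I) = (?R (I - {a}) - ?R (I - {b})) * ?Q I"
      by (simp only: divided_difference_recursion[OF less.prems(1,3) a b(1)] mult.assoc)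
    also have "\<dots> = fps_X ^ (card I - 2) * (lin_factor (v a) - lin_factor (v b))"
      by (simp only: left_diff_distrib right_diff_distrib remove[OF a] remove[OF b(1)])
    finally have "fps_const (v b - v a) * (?R I * ?Q I)
        = fps_const (v b - v a) * fps_X ^ Suc (card I - 2)"
      by (simp add: lin_factor_diff mult_ac)
    moreover have "v b \<noteq> v a" using inj_onD[OF less.prems(3)] a b by blast
    moreover have "Suc (card I - 2) = card I - 1"
      using card_mono[OF less.prems(1), of "{a, b}"] a b by simp
    ultimately show ?thesis by simp
  qed
qed

text \<open>The residue at \<open>x i\<close> of the rational function \<open>(\<Prod>j\<in>J. z - y j) / (\<Prod>i\<in>I. z - x i)\<close> of \<open>z\<close>.\<close>
definition ratio_residue ::
    "('j \<Rightarrow> 'a::field) \<Rightarrow> 'j set \<Rightarrow> ('i \<Rightarrow> 'a) \<Rightarrow> 'i set \<Rightarrow> 'i \<Rightarrow> 'a" where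
  "ratio_residue y J x I i = (\<Prod>j\<in>J. x i - y j) / (\<Prod>j\<in>I - {i}. x i - x j)"

definition ratio_series ::
    "('j \<Rightarrow> 'a::field) \<Rightarrow> 'j set \<Rightarrow> ('i \<Rightarrow> 'a) \<Rightarrow> 'i set \<Rightarrow> 'a fps" where
  "ratio_series y J x I = (\<Prod>j\<in>J. lin_factor (y j)) / (\<Prod>i\<in>I. lin_factor (x i))"

lemma ratio_series_mult: "ratio_series y J x I * (\<Prod>i\<in>I. lin_factor (x i)) = (\<Prod>j\<in>J. lin_factor (y j))"
  by (simp add: ratio_series_def fps_divide_unit mult.assoc inverse_mult_eq_1)

lemma ratio_series_nth_0 [simp]: "fps_nth (ratio_series y J x I) 0 = 1"
  by (simp add: ratio_series_def)

lemma sum_ratio_residue_power: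
  assumes "finite I" "I \<noteq> {}" "inj_on x I" "finite J" "card I \<le> Suc (k + card J)"
  shows "(\<Sum>i\<in>I. ratio_residue y J x I i * x i ^ k)
    = fps_nth (ratio_series y J x I) (Suc (k + card J) - card I)"
proof -
  let ?P = "\<Prod>j\<in>J. lin_factor (y j)" and ?Q = "\<Prod>i\<in>I. lin_factor (x i)"
  let ?R = "divided_difference x (\<lambda>i. inverse (lin_factor (x i))) I"
  have "ratio_series y J x I * fps_X ^ (card I - 1) * ?Q = ?P * ?R * ?Q"
    unfolding divided_difference_inverse_lin_factor[OF assms(1-3), symmetric]
      ratio_series_mult[of y J x I, symmetric]
    by (simp only: mult_ac)
  then have series: "ratio_series y J x I * fps_X ^ (card I - 1) = ?P * ?R"
    using prod_lin_factor_nonzero[of x I] by simp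
  have "(\<Sum>i\<in>I. ratio_residue y J x I i * x i ^ k) = (\<Sum>i\<in>I.
      inverse (\<Prod>j\<in>I - {i}. x i - x j) * fps_nth (?P * inverse (lin_factor (x i))) (k + card J))"
    unfolding prod_lin_factor_mult_inverse_nth[OF assms(4)]
    by (simp add: ratio_residue_def divide_inverse mult_ac)
  also have "\<dots> = fps_nth (?P * ?R) (k + card J)"
    by (simp add: divided_difference_def sum_distrib_left fps_sum_nth mult.left_commute[of ?P])
  also have "\<dots> = fps_nth (ratio_series y J x I) (Suc (k + card J) - card I)"
    unfolding series[symmetric] using assms(1,2,5)
    by (auto simp: fps_X_power_mult_right_nth Suc_diff_le card_gt_0_iff Suc_le_eq)
  finally show ?thesis .
qed

lemma fps_deriv_prod_lin_factor:
  "fps_X * fps_deriv (\<Prod>a\<in>A. lin_factor (x a))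
    = - ((\<Prod>a\<in>A. lin_factor (x a)) * (\<Sum>a\<in>A. inverse (lin_factor (x a)) - 1))"
proof (induction A rule: infinite_finite_induct)
  case (insert a A)
  let ?P = "\<Prod>a\<in>A. lin_factor (x a)" and ?S = "\<Sum>a\<in>A. inverse (lin_factor (x a)) - 1"
  have "lin_factor (x a) * inverse (lin_factor (x a)) = 1"
    by (simp add: inverse_mult_eq_1')
  then have factor: "fps_X * fps_deriv (lin_factor (x a))
      = - (lin_factor (x a) * (inverse (lin_factor (x a)) - 1))"
    by (simp add: right_diff_distrib) (simp add: lin_factor_def mult.commute flip: fps_const_neg)
  have "fps_X * fps_deriv (lin_factor (x a) * ?P)
      = (fps_X * fps_deriv (lin_factor (x a))) * ?P + lin_factor (x a) * (fps_X * fps_deriv ?P)"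
    by (simp add: algebra_simps)
  also have "\<dots> = - (lin_factor (x a) * ?P * ((inverse (lin_factor (x a)) - 1) + ?S))"
    unfolding factor insert.IH by (simp add: algebra_simps)
  finally show ?case using insert.hyps by simp
qed simp_all

lemma ratio_series_deriv:
  "fps_X * fps_deriv (ratio_series y J x I) = ratio_series y J x I *
    ((\<Sum>i\<in>I. inverse (lin_factor (x i)) - 1) - (\<Sum>j\<in>J. inverse (lin_factor (y j)) - 1))"
proof -
  let ?G = "ratio_series y J x I"
  let ?P = "\<Prod>j\<in>J. lin_factor (y j)" and ?Q = "\<Prod>i\<in>I. lin_factor (x i)"
  let ?SP = "\<Sum>j\<in>J. inverse (lin_factor (y j)) - 1" and ?SQ = "\<Sum>i\<in>I. inverse (lin_factor (x i)) - 1"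
  have "(fps_X * fps_deriv ?G) * ?Q = fps_X * fps_deriv (?G * ?Q) - ?G * (fps_X * fps_deriv ?Q)"
    by (simp add: algebra_simps)
  also have "\<dots> = ?G * ?Q * ?SQ - ?P * ?SP"
    unfolding ratio_series_mult fps_deriv_prod_lin_factor
    by (simp add: ratio_series_mult[of y J x I, symmetric] algebra_simps)
  also have "\<dots> = (?G * (?SQ - ?SP)) * ?Q"
    by (simp add: ratio_series_mult[of y J x I, symmetric] algebra_simps)
  finally show ?thesis using prod_lin_factor_nonzero[of x I] by simp
qed

lemma ratio_series_newton:
  "of_nat k * fps_nth (ratio_series y J x I) k
    = (\<Sum>r<k. fps_nth (ratio_series y J x I) r * ((\<Sum>i\<in>I. x i ^ (k - r)) - (\<Sum>j\<in>J. y j ^ (k - r))))"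
proof -
  let ?G = "ratio_series y J x I"
  define H where "H = (\<Sum>i\<in>I. inverse (lin_factor (x i)) - 1) - (\<Sum>j\<in>J. inverse (lin_factor (y j)) - 1)"
  have H_nth: "fps_nth H n = (if n = 0 then 0 else (\<Sum>i\<in>I. x i ^ n) - (\<Sum>j\<in>J. y j ^ n))" for n
    by (simp add: H_def fps_sum_nth)
  have "of_nat k * fps_nth ?G k = fps_nth (fps_X * fps_deriv ?G) k"
    by (cases k) simp_all
  also have "\<dots> = fps_nth (?G * H) k" by (simp only: ratio_series_deriv H_def)
  also have "\<dots> = (\<Sum>r\<in>{0..k}. fps_nth ?G r * fps_nth H (k - r))"
    by (rule fps_mult_nth)
  also have "\<dots> = (\<Sum>r<k. fps_nth ?G r * fps_nth H (k - r))"
    by (rule sum.mono_neutral_right) (auto simp: H_nth)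
  finally show ?thesis by (simp add: H_nth)
qed

definition vandermonde :: "nat \<Rightarrow> (nat \<Rightarrow> 'a::comm_ring_1) \<Rightarrow> 'a" where
  "vandermonde N e = (\<Prod>j<N. \<Prod>i<j. e i - e j)"

lemma vandermonde_Suc: "vandermonde (Suc N) e = vandermonde N e * (\<Prod>i<N. e i - e N)"
  by (simp add: vandermonde_def)

lemma vandermonde_cong: "(\<And>i. i < N \<Longrightarrow> e i = f i) \<Longrightarrow> vandermonde N e = vandermonde N f"
  by (simp add: vandermonde_def)

lemma vandermonde_fun_upd:
  "i < N \<Longrightarrow> vandermonde N (e(i := x)) * (\<Prod>j\<in>{..<N} - {i}. e i - e j)
    = vandermonde N e * (\<Prod>j\<in>{..<N} - {i}. x - e j)"
proof (induction N)
  case (Suc N)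
  show ?case
  proof (cases "i = N")
    case True
    have "{..<Suc N} - {N} = {..<N}" by auto
    moreover have "vandermonde N (e(i := x)) = vandermonde N e"
      by (rule vandermonde_cong) (simp add: True)
    moreover have "(\<Prod>j<N. e j - x) * (\<Prod>j<N. e N - e j) = (\<Prod>j<N. e j - e N) * (\<Prod>j<N. x - e j)"
      unfolding prod.distrib[symmetric] by (rule prod.cong) (simp_all add: algebra_simps)
    ultimately show ?thesis using True by (simp add: vandermonde_Suc mult.assoc del: fun_upd_apply) simp
  next
    case False
    with Suc.prems have i: "i < N" by simp
    have split: "(\<Prod>j\<in>{..<Suc N} - {i}. f j) = (\<Prod>j\<in>{..<N} - {i}. f j) * f N" for f :: "nat \<Rightarrow> 'a"
      using i by (simp add: lessThan_Suc insert_Diff_if mult.commute)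
    have "vandermonde (Suc N) (e(i := x)) * (\<Prod>j\<in>{..<Suc N} - {i}. e i - e j)
        = (vandermonde N (e(i := x)) * (\<Prod>j\<in>{..<N} - {i}. e i - e j))
          * ((x - e N) * (\<Prod>j\<in>{..<N} - {i}. e j - e N) * (e i - e N))"
    proof -
      have "(\<Prod>j<N. (e(i := x)) j - e N) = (x - e N) * (\<Prod>j\<in>{..<N} - {i}. e j - e N)"
        using i by (subst prod.remove[of _ i]) auto
      then show ?thesis using False by (simp add: vandermonde_Suc split mult_ac)
    qed
    also have "\<dots> = vandermonde N e * (\<Prod>j\<in>{..<N} - {i}. x - e j)
        * ((x - e N) * ((e i - e N) * (\<Prod>j\<in>{..<N} - {i}. e j - e N)))"
      by (simp only: Suc.IH[OF i] mult_ac)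
    also have "(e i - e N) * (\<Prod>j\<in>{..<N} - {i}. e j - e N) = (\<Prod>j<N. e j - e N)"
      using i by (subst (2) prod.remove[of _ i]) auto
    finally show ?thesis by (simp add: vandermonde_Suc split mult_ac)
  qed
qed simp

section \<open>Young diagrams and their corners\<close>

definition row :: "nat list \<Rightarrow> nat \<Rightarrow> nat" where
  "row l i = (if i < length l then l ! i else 0)"

definition of_rows :: "(nat \<Rightarrow> nat) \<Rightarrow> nat list" where
  "of_rows r = map r [0..<(LEAST n. r n = 0)]"

lemma row_beyond_length [simp]: "length l \<le> i \<Longrightarrow> row l i = 0"
  by (simp add: row_def)

lemma young_Nil [simp]: "young []"
  by (simp add: young_def)

lemma row_antimono: "young l \<Longrightarrow> i \<le> j \<Longrightarrow> row l j \<le> row l i"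
  unfolding young_def row_def sorted_wrt_iff_nth_less
  by (auto simp: le_less)

lemma row_eq_0_iff: "young l \<Longrightarrow> row l i = 0 \<longleftrightarrow> length l \<le> i"
  by (cases "i < length l") (auto simp: young_def row_def in_set_conv_nth)

lemma row_inject:
  assumes "young l" "young m" "row l = row m"
  shows "l = m"
proof (rule nth_equalityI)
  show len: "length l = length m"
    using assms row_eq_0_iff by (metis dual_order.antisym order_refl)
  fix i assume "i < length l"
  then show "l ! i = m ! i"
    using fun_cong[OF assms(3), of i] len by (simp add: row_def)
qed

lemma
  assumes "antimono r" "r N = 0"
  shows young_of_rows: "young (of_rows r)" and row_of_rows: "row (of_rows r) = r"
proof -
  define L where "L = (LEAST n. r n = 0)"
  have L0: "r L = 0" unfolding L_def using assms(2) by (rule LeastI)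
  have Lpos: "0 < r i" if "i < L" for i
    using not_less_Least[of i "\<lambda>n. r n = 0"] that unfolding L_def by auto
  have anti: "i \<le> j \<Longrightarrow> r j \<le> r i" for i j
    using assms(1) by (rule antimonoD)
  show "young (of_rows r)"
    unfolding young_def of_rows_def L_def[symmetric]
    using anti Lpos by (fastforce simp: sorted_wrt_iff_nth_less)
  show "row (of_rows r) = r"
  proof
    fix i
    have "r i = 0" if "L \<le> i" using anti[OF that] L0 by simp
    then show "row (of_rows r) i = r i"
      by (simp add: row_def of_rows_def L_def[symmetric])
  qed
qed

lemma sum_list_row:
  assumes "length l \<le> N"
  shows "sum_list l = (\<Sum>i<N. row l i)"
proof -
  have "(\<Sum>i<N. row l i) = (\<Sum>i<length l. row l i)"
    using assms by (intro sum.mono_neutral_right) auto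
  then show ?thesis
    by (simp add: sum_list_sum_nth row_def atLeast0LessThan)
qed

lemma mem_boxes_iff: "(i, j) \<in> boxes l \<longleftrightarrow> 1 \<le> i \<and> 1 \<le> j \<and> j \<le> row l (i - 1)"
  unfolding boxes_def row_def by (auto split: if_splits)

lemma boxes_subset_iff: "boxes l \<subseteq> boxes m \<longleftrightarrow> (\<forall>i. row l i \<le> row m i)"
proof (intro iffI allI)
  fix i assume subset: "boxes l \<subseteq> boxes m"
  show "row l i \<le> row m i"
  proof (cases "row l i = 0")
    case False
    then have "(Suc i, row l i) \<in> boxes l" by (simp add: mem_boxes_iff)
    with subset have "(Suc i, row l i) \<in> boxes m" by blast
    then show ?thesis by (simp add: mem_boxes_iff)
  qed simp
qed (auto simp: mem_boxes_iff; metis le_trans)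

lemma covers_youngD: "mu \<nearrow> lam \<Longrightarrow> young mu" "mu \<nearrow> lam \<Longrightarrow> young lam"
  by (auto simp: covers_def)

lemma covers_sum_list: "mu \<nearrow> lam \<Longrightarrow> sum_list lam = Suc (sum_list mu)"
  by (auto simp: covers_def)

lemma covers_rowI:
  assumes "young mu" "young lam" "row lam = (row mu)(i := Suc (row mu i))"
  shows "mu \<nearrow> lam"
proof -
  define N where "N = Suc (i + length mu + length lam)"
  have "sum_list lam = (\<Sum>j<N. ((row mu)(i := Suc (row mu i))) j)"
    using sum_list_row[of lam N] assms(3) by (simp add: N_def)
  also have "\<dots> = (\<Sum>j<N. row mu j + (if j = i then 1 else 0))"
    by (intro sum.cong) auto
  also have "\<dots> = sum_list mu + 1"
    using sum_list_row[of mu N] by (simp add: sum.distrib N_def)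
  finally show ?thesis
    using assms by (auto simp: covers_def boxes_subset_iff)
qed

lemma covers_rowE:
  assumes "mu \<nearrow> lam"
  obtains i where "row lam = (row mu)(i := Suc (row mu i))"
proof -
  define N where "N = max (length mu) (length lam)"
  have le: "row mu i \<le> row lam i" for i
    using assms unfolding covers_def boxes_subset_iff by blast
  have "(\<Sum>i<N. row lam i) = (\<Sum>i<N. row mu i) + 1"
    using covers_sum_list[OF assms] sum_list_row[of lam N] sum_list_row[of mu N] by (simp add: N_def)
  then have "(\<Sum>i<N. row lam i - row mu i) = 1"
    using le by (simp add: sum_subtractf_nat)
  then obtain i where i: "i < N" "row lam i - row mu i = 1"
      "\<And>j. j < N \<Longrightarrow> j \<noteq> i \<Longrightarrow> row lam j - row mu j = 0"
    using sum_eq_1_iff[of "{..<N}" "\<lambda>i. row lam i - row mu i"] by (auto simp del: diff_is_0_eq)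
  have "row lam j = ((row mu)(i := Suc (row mu i))) j" for j
  proof (cases "j < N \<and> j \<noteq> i")
    case True
    then show ?thesis using i(3)[of j] le[of j] by simp
  next
    case False
    then show ?thesis using i(1,2) by (auto simp: N_def not_less)
  qed
  then show ?thesis by (intro that ext)
qed

text \<open>Rows are numbered from \<open>0\<close>, whereas the boxes are numbered from \<open>(1, 1)\<close>.\<close>
definition addable :: "nat list \<Rightarrow> nat set" where
  "addable l = {i. i = 0 \<or> row l i < row l (i - 1)}"

definition removable :: "nat list \<Rightarrow> nat set" where
  "removable l = {i. row l (Suc i) < row l i}"

definition add_box :: "nat list \<Rightarrow> nat \<Rightarrow> nat list" where
  "add_box l i = of_rows ((row l)(i := Suc (row l i)))"

definition remove_box :: "nat list \<Rightarrow> nat \<Rightarrow> nat list" where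
  "remove_box l i = of_rows ((row l)(i := row l i - 1))"

lemma addable_eq_removable: "addable l = insert 0 (Suc ` removable l)"
proof (rule set_eqI)
  fix i show "i \<in> addable l \<longleftrightarrow> i \<in> insert 0 (Suc ` removable l)"
    by (cases i) (auto simp: addable_def removable_def)
qed

lemma removable_less_length: "i \<in> removable l \<Longrightarrow> i < length l"
  by (rule ccontr) (simp add: removable_def)

lemma addable_le_length: "i \<in> addable l \<Longrightarrow> i \<le> length l"
  by (auto simp: addable_eq_removable dest: removable_less_length)

lemma finite_removable [simp]: "finite (removable l)"
  by (rule finite_subset[of _ "{..<length l}"]) (auto dest: removable_less_length)

lemma finite_addable [simp]: "finite (addable l)"
  by (simp add: addable_eq_removable)

lemma
  assumes "young l" "i \<in> addable l"
  shows young_add_box: "young (add_box l i)"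
    and row_add_box: "row (add_box l i) = (row l)(i := Suc (row l i))"
proof -
  let ?r = "(row l)(i := Suc (row l i))"
  have "?r (Suc k) \<le> ?r k" for k
    using assms row_antimono[OF assms(1), of k "Suc k"] by (auto simp: addable_def)
  then have "antimono ?r" by (simp add: antimono_iff_le_Suc)
  moreover have "?r (Suc i + length l) = 0" by simp
  ultimately show "young (add_box l i)" "row (add_box l i) = ?r"
    unfolding add_box_def by (rule young_of_rows, rule row_of_rows)
qed

lemma
  assumes "young l" "i \<in> removable l"
  shows young_remove_box: "young (remove_box l i)"
    and row_remove_box: "row (remove_box l i) = (row l)(i := row l i - 1)"
proof -
  let ?r = "(row l)(i := row l i - 1)"
  have "?r (Suc k) \<le> ?r k" for k
    using assms row_antimono[OF assms(1), of k "Suc k"] by (auto simp: removable_def)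
  then have "antimono ?r" by (simp add: antimono_iff_le_Suc)
  moreover have "?r (Suc i + length l) = 0" by simp
  ultimately show "young (remove_box l i)" "row (remove_box l i) = ?r"
    unfolding remove_box_def by (rule young_of_rows, rule row_of_rows)
qed

lemma remove_add_box:
  assumes "young l" "i \<in> addable l"
  shows "i \<in> removable (add_box l i)" "remove_box (add_box l i) i = l"
proof -
  show removable: "i \<in> removable (add_box l i)"
    using assms row_antimono[OF assms(1), of i "Suc i"] by (simp add: removable_def row_add_box)
  show "remove_box (add_box l i) i = l"
    by (rule row_inject)
       (use assms removable in \<open>auto simp: row_remove_box row_add_box young_add_box young_remove_box\<close>)
qed

lemma add_remove_box:
  assumes "young l" "i \<in> removable l"
  shows "i \<in> addable (remove_box l i)" "add_box (remove_box l i) i = l"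
proof -
  show addable: "i \<in> addable (remove_box l i)"
    using assms row_antimono[OF assms(1), of "i - 1" i]
    by (auto simp: addable_def row_remove_box removable_def)
  show "add_box (remove_box l i) i = l"
    by (rule row_inject)
       (use assms addable in \<open>auto simp: row_remove_box row_add_box young_add_box young_remove_box
          removable_def\<close>)
qed

lemma covers_add_box: "young l \<Longrightarrow> i \<in> addable l \<Longrightarrow> l \<nearrow> add_box l i"
  by (rule covers_rowI) (simp_all add: young_add_box row_add_box)

lemma covers_remove_box: "young l \<Longrightarrow> i \<in> removable l \<Longrightarrow> remove_box l i \<nearrow> l"
  using covers_add_box[of "remove_box l i" i] by (simp add: young_remove_box add_remove_box)

lemma sum_list_add_box: "young l \<Longrightarrow> i \<in> addable l \<Longrightarrow> sum_list (add_box l i) = Suc (sum_list l)"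
  by (intro covers_sum_list covers_add_box)

lemma Suc_sum_list_remove_box:
  "young l \<Longrightarrow> i \<in> removable l \<Longrightarrow> Suc (sum_list (remove_box l i)) = sum_list l"
  by (intro covers_sum_list[symmetric] covers_remove_box)

lemma length_add_box_le: "young l \<Longrightarrow> i \<in> addable l \<Longrightarrow> length (add_box l i) \<le> Suc (length l)"
  using row_eq_0_iff[OF young_add_box, of l i "Suc (length l)"] addable_le_length[of i l]
  by (simp add: row_add_box)

lemma length_remove_box_le: "young l \<Longrightarrow> i \<in> removable l \<Longrightarrow> length (remove_box l i) \<le> length l"
  using row_eq_0_iff[OF young_remove_box, of l i "length l"] removable_less_length[of i l]
  by (simp add: row_remove_box)

lemma inj_on_add_box: "young l \<Longrightarrow> inj_on (add_box l) (addable l)"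
proof (rule inj_onI)
  fix i j assume "young l" "i \<in> addable l" "j \<in> addable l" "add_box l i = add_box l j"
  then have "(row l)(i := Suc (row l i)) = (row l)(j := Suc (row l j))"
    by (metis row_add_box)
  then show "i = j"
    by (metis fun_upd_other fun_upd_same n_not_Suc_n)
qed

lemma inj_on_remove_box: "young l \<Longrightarrow> inj_on (remove_box l) (removable l)"
proof (rule inj_onI)
  fix i j assume ij: "young l" "i \<in> removable l" "j \<in> removable l" "remove_box l i = remove_box l j"
  then have "(row l)(i := row l i - 1) = (row l)(j := row l j - 1)"
    by (metis row_remove_box)
  then have "row l i - 1 = ((row l)(j := row l j - 1)) i"
    by (metis fun_upd_same)
  then show "i = j"
    using ij(2) by (auto simp: removable_def split: if_splits)
qed

lemma covers_add_boxE:
  assumes "l \<nearrow> nu"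
  obtains i where "i \<in> addable l" "nu = add_box l i"
proof -
  note young = covers_youngD[OF assms]
  obtain i where r: "row nu = (row l)(i := Suc (row l i))"
    using covers_rowE[OF assms] .
  have i: "i \<in> addable l"
    using r row_antimono[OF young(2), of "i - 1" i] by (cases i) (auto simp: addable_def)
  moreover have "nu = add_box l i"
    by (rule row_inject)
       (simp_all add: young young_add_box[OF young(1) i] row_add_box[OF young(1) i] r)
  ultimately show ?thesis using that by blast
qed

lemma covers_add_box_eq: "young l \<Longrightarrow> {nu. l \<nearrow> nu} = add_box l ` addable l"
  by (auto elim: covers_add_boxE intro: covers_add_box)

lemma covers_remove_box_eq: "young l \<Longrightarrow> {mu. mu \<nearrow> l} = remove_box l ` removable l"
proof (intro equalityI subsetI)
  fix mu assume "mu \<in> {mu. mu \<nearrow> l}"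
  then have "mu \<nearrow> l" by simp
  moreover then obtain i where "i \<in> addable mu" "l = add_box mu i" by (rule covers_add_boxE)
  ultimately show "mu \<in> remove_box l ` removable l"
    using remove_add_box covers_youngD(1) by (intro image_eqI[of _ _ i]) auto
qed (auto intro: covers_remove_box)

lemma sum_covering: "young l \<Longrightarrow> (\<Sum>nu | l \<nearrow> nu. f nu) = (\<Sum>i\<in>addable l. f (add_box l i))"
  by (simp add: covers_add_box_eq sum.reindex[OF inj_on_add_box])

lemma sum_covered: "young l \<Longrightarrow> (\<Sum>mu | mu \<nearrow> l. f mu) = (\<Sum>i\<in>removable l. f (remove_box l i))"
  by (simp add: covers_remove_box_eq sum.reindex[OF inj_on_remove_box])

lemma addable_removable_exchange_iff:
  assumes "young l" "i \<noteq> k"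
  shows "i \<in> addable l \<and> k \<in> removable (add_box l i) \<longleftrightarrow> k \<in> removable l \<and> i \<in> addable (remove_box l k)"
proof
  assume ik: "i \<in> addable l \<and> k \<in> removable (add_box l i)"
  then have k: "k \<in> removable l" using assms by (auto simp: removable_def row_add_box split: if_splits)
  moreover have "i \<in> addable (remove_box l k)"
  proof (cases "i = Suc k")
    case True
    then have "Suc (row l i) < row l k" using ik assms by (auto simp: removable_def row_add_box)
    then show ?thesis using True by (auto simp: addable_def row_remove_box[OF assms(1) k])
  next
    case False
    then show ?thesis using ik assms by (auto simp: addable_def row_remove_box[OF assms(1) k])
  qed
  ultimately show "k \<in> removable l \<and> i \<in> addable (remove_box l k)" by blast
next
  assume ik: "k \<in> removable l \<and> i \<in> addable (remove_box l k)"
  then have i: "i \<in> addable l" using assms by (auto simp: addable_def row_remove_box split: if_splits)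
  moreover have "k \<in> removable (add_box l i)"
  proof (cases "i = Suc k")
    case True
    then have "row l i < row l k - 1" using ik assms by (auto simp: addable_def row_remove_box)
    then show ?thesis using True i by (auto simp: removable_def row_add_box[OF assms(1)])
  next
    case False
    then show ?thesis using ik assms by (auto simp: removable_def row_add_box[OF assms(1) i])
  qed
  ultimately show "i \<in> addable l \<and> k \<in> removable (add_box l i)" by blast
qed

lemma remove_add_box_commute:
  assumes "young l" "i \<noteq> k" "i \<in> addable l" "k \<in> removable (add_box l i)"
  shows "remove_box (add_box l i) k = add_box (remove_box l k) i"
proof -
  have k: "k \<in> removable l" "i \<in> addable (remove_box l k)"
    using addable_removable_exchange_iff assms by blast+
  note young = young_add_box[OF assms(1,3)] young_remove_box[OF assms(1) k(1)]
  show ?thesis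
  proof (rule row_inject)
    show "row (remove_box (add_box l i) k) = row (add_box (remove_box l k) i)"
      using assms(2) by (auto simp: row_remove_box[OF young(1) assms(4)] row_add_box[OF young(2) k(2)]
          row_add_box[OF assms(1,3)] row_remove_box[OF assms(1) k(1)])
  qed (use young_remove_box[OF young(1) assms(4)] young_add_box[OF young(2) k(2)] in auto)
qed

lemma boxes_add_box:
  assumes "young l" "i \<in> addable l"
  shows "boxes (add_box l i) - boxes l = {(Suc i, Suc (row l i))}"
proof -
  have "(p, q) \<in> boxes (add_box l i) - boxes l \<longleftrightarrow> (p, q) = (Suc i, Suc (row l i))" for p q
    unfolding Diff_iff mem_boxes_iff row_add_box[OF assms] by (cases p) auto
  then show ?thesis by auto
qed

lemma finite_Ydiag: "finite (Ydiag n)"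
proof (rule finite_subset)
  show "finite {xs. set xs \<subseteq> {..n} \<and> length xs \<le> n}"
    by (rule finite_lists_length_le) simp
  show "Ydiag n \<subseteq> {xs. set xs \<subseteq> {..n} \<and> length xs \<le> n}"
  proof
    fix xs assume "xs \<in> Ydiag n"
    then have xs: "0 \<notin> set xs" "sum_list xs = n" by (auto simp: Ydiag_def young_def)
    have "length xs \<le> sum_list xs"
      using xs(1) by (induction xs) auto
    moreover have "x \<in> set xs \<Longrightarrow> x \<le> sum_list xs" for x
      by (simp add: member_le_sum_list)
    ultimately show "xs \<in> {xs. set xs \<subseteq> {..n} \<and> length xs \<le> n}" using xs by auto
  qed
qed

section \<open>Contents\<close>

text \<open>The boxes of row \<open>i\<close> have the contents \<open>- i, \<dots>, edge l i - 1\<close>, and \<open>edge l i\<close> is the content of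
  the box that may be added to that row.\<close>
definition edge :: "nat list \<Rightarrow> nat \<Rightarrow> real" where
  "edge l i = real (row l i) - real i"

lemma edge_beyond_length: "length l \<le> i \<Longrightarrow> edge l i = - real i"
  by (simp add: edge_def)

lemma edge_strict_antimono: "young l \<Longrightarrow> i < j \<Longrightarrow> edge l j < edge l i"
  using row_antimono[of l i j] by (simp add: edge_def)

lemma inj_edge: "young l \<Longrightarrow> inj (edge l)"
  by (rule injI) (metis linorder_neqE_nat edge_strict_antimono less_irrefl)

lemma edge_add_box:
  "young l \<Longrightarrow> i \<in> addable l \<Longrightarrow> edge (add_box l i) = (edge l)(i := edge l i + 1)"
  by (auto simp: edge_def row_add_box)

lemma edge_remove_box:
  "young l \<Longrightarrow> i \<in> removable l \<Longrightarrow> edge (remove_box l i) = (edge l)(i := edge l i - 1)"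
  by (auto simp: edge_def row_remove_box removable_def)

lemma edge_Suc_not_removable:
  assumes "young l" "i \<notin> removable l"
  shows "edge l (Suc i) = edge l i - 1"
proof -
  have "row l (Suc i) = row l i"
    using assms row_antimono[OF assms(1), of i "Suc i"] by (simp add: removable_def)
  then show ?thesis by (simp add: edge_def)
qed

definition edge_sum :: "(real \<Rightarrow> real) \<Rightarrow> nat list \<Rightarrow> real" where
  "edge_sum \<phi> l = (\<Sum>i<length l. \<phi> (edge l i) - \<phi> (- real i))"

lemma edge_sum_extend: "length l \<le> N \<Longrightarrow> edge_sum \<phi> l = (\<Sum>i<N. \<phi> (edge l i) - \<phi> (- real i))"
  unfolding edge_sum_def by (intro sum.mono_neutral_left) (auto simp: edge_beyond_length)

lemma edge_sum_cmult: "edge_sum (\<lambda>x. c * \<phi> x) l = c * edge_sum \<phi> l"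
  by (simp add: edge_sum_def sum_distrib_left algebra_simps)

lemma edge_sum_sum: "edge_sum (\<lambda>x. \<Sum>a\<in>A. \<phi> a x) l = (\<Sum>a\<in>A. edge_sum (\<phi> a) l)"
  unfolding edge_sum_def by (subst sum.swap) (simp add: sum_subtractf)

lemma edge_sum_linear: "edge_sum (\<lambda>x. c * x + d) l = c * real (sum_list l)"
  by (simp add: edge_sum_def edge_def sum_list_row[of l "length l"] sum_distrib_left algebra_simps)

lemma edge_sum_add_box:
  assumes "young l" "i \<in> addable l"
  shows "edge_sum \<phi> (add_box l i) = edge_sum \<phi> l + (\<phi> (edge l i + 1) - \<phi> (edge l i))"
proof -
  let ?N = "Suc (length l)"
  have "edge_sum \<phi> (add_box l i)
      = (\<Sum>j<?N. \<phi> (edge l j) - \<phi> (- real j) + (if j = i then \<phi> (edge l i + 1) - \<phi> (edge l i) else 0))"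
    unfolding edge_sum_extend[OF length_add_box_le[OF assms]]
    by (rule sum.cong) (auto simp: edge_add_box[OF assms])
  also have "\<dots> = edge_sum \<phi> l + (\<phi> (edge l i + 1) - \<phi> (edge l i))"
    using edge_sum_extend[of l ?N \<phi>] addable_le_length[OF assms(2)]
    by (simp add: sum.distrib del: sum.lessThan_Suc)
  finally show ?thesis .
qed

lemma edge_sum_remove_box:
  assumes "young l" "i \<in> removable l"
  shows "edge_sum \<phi> (remove_box l i) = edge_sum \<phi> l - (\<phi> (edge l i) - \<phi> (edge l i - 1))"
  using edge_sum_add_box[OF young_remove_box[OF assms] add_remove_box(1)[OF assms], of \<phi>]
  by (simp add: add_remove_box(2)[OF assms] edge_remove_box[OF assms])

text \<open>Kerov's interlacing coordinates: the contents of the addable and of the removable boxes.\<close>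
definition interlacing_sum :: "(real \<Rightarrow> real) \<Rightarrow> nat list \<Rightarrow> real" where
  "interlacing_sum \<phi> l = (\<Sum>i\<in>addable l. \<phi> (edge l i)) - (\<Sum>i\<in>removable l. \<phi> (edge l i - 1))"

lemma interlacing_sum_rows:
  assumes "young l" "length l \<le> N"
  shows "interlacing_sum \<phi> l = (\<Sum>i<Suc N. \<phi> (edge l i)) - (\<Sum>i<N. \<phi> (edge l i - 1))"
proof -
  have "(\<Sum>i\<in>addable l. \<phi> (edge l i)) = \<phi> (edge l 0) + (\<Sum>i\<in>removable l. \<phi> (edge l (Suc i)))"
    unfolding addable_eq_removable by (subst sum.insert) (auto simp: sum.reindex)
  then have "interlacing_sum \<phi> l
      = \<phi> (edge l 0) + (\<Sum>i\<in>removable l. \<phi> (edge l (Suc i)) - \<phi> (edge l i - 1))"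
    by (simp add: interlacing_sum_def sum_subtractf)
  also have "(\<Sum>i\<in>removable l. \<phi> (edge l (Suc i)) - \<phi> (edge l i - 1))
      = (\<Sum>i<N. \<phi> (edge l (Suc i)) - \<phi> (edge l i - 1))"
    using assms by (intro sum.mono_neutral_left)
      (auto simp: edge_Suc_not_removable dest!: removable_less_length)
  finally show ?thesis
    by (simp add: sum.lessThan_Suc_shift sum_subtractf del: sum.lessThan_Suc)
qed

lemma interlacing_sum_eq_edge_sum:
  assumes "young l"
  shows "interlacing_sum \<phi> l = \<phi> 0 + edge_sum (\<lambda>x. \<phi> x - \<phi> (x - 1)) l"
proof -
  let ?N = "length l"
  have telescope: "(\<Sum>i<?N. \<phi> (- real i) - \<phi> (- real i - 1)) = \<phi> 0 - \<phi> (- real ?N)"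
    using sum_lessThan_telescope'[of "\<lambda>i. \<phi> (- real i)" ?N] by (simp add: minus_diff_commute)
  have "edge_sum (\<lambda>x. \<phi> x - \<phi> (x - 1)) l
      = (\<Sum>i<?N. \<phi> (edge l i)) - (\<Sum>i<?N. \<phi> (edge l i - 1)) - (\<phi> 0 - \<phi> (- real ?N))"
    unfolding telescope[symmetric] by (simp add: edge_sum_def sum_subtractf)
  then show ?thesis
    by (simp add: interlacing_sum_rows[OF assms order_refl] edge_beyond_length)
qed

lemma interlacing_sum_quadratic:
  assumes "young l"
  shows "interlacing_sum (\<lambda>x. a + b * x + x\<^sup>2) l = a + 2 * real (sum_list l)"
proof -
  have "a + b * x + x\<^sup>2 - (a + b * (x - 1) + (x - 1)\<^sup>2) = 2 * x + (b - 1)" for x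
    by (simp add: power2_eq_square algebra_simps)
  then show ?thesis
    by (simp add: interlacing_sum_eq_edge_sum[OF assms] edge_sum_linear)
qed

section \<open>Frobenius coordinates\<close>

lemma mem_downward_closed_iff:
  fixes A :: "nat set"
  assumes "finite A" "A \<subseteq> {1..}" "\<And>i j. i \<in> A \<Longrightarrow> 1 \<le> j \<Longrightarrow> j \<le> i \<Longrightarrow> j \<in> A"
  shows "i \<in> A \<longleftrightarrow> 1 \<le> i \<and> i \<le> card A"
proof (cases "A = {}")
  case False
  have "A = {1..Max A}"
    using assms(2) assms(3)[OF Max_in[OF assms(1) False]] Max_ge[OF assms(1)] by auto
  then have "A = {1..card A}" by (metis card_atLeastAtMost diff_Suc_1)
  then show ?thesis by (metis atLeastAtMost_iff)
qed simp

lemma boxes_downward_closed: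
  assumes "young l" "(i, j) \<in> boxes l" "1 \<le> i'" "i' \<le> i" "1 \<le> j'" "j' \<le> j"
  shows "(i', j') \<in> boxes l"
  using assms row_antimono[OF assms(1), of "i' - 1" "i - 1"] by (auto simp: mem_boxes_iff diff_le_mono)

lemma diag_mem_boxes_iff:
  assumes "young l" "1 \<le> i"
  shows "(i, i) \<in> boxes l \<longleftrightarrow> i \<le> diag_len l"
proof -
  have diag_len: "diag_len l = card {i. (i, i) \<in> boxes l}"
    by (simp add: diag_len_def boxes_def conj_ac)
  have "{i. (i, i) \<in> boxes l} \<subseteq> {1..length l}" by (auto simp: boxes_def)
  then have "i \<in> {i. (i, i) \<in> boxes l} \<longleftrightarrow> 1 \<le> i \<and> i \<le> card {i. (i, i) \<in> boxes l}"
    using boxes_downward_closed[OF assms(1)]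
    by (intro mem_downward_closed_iff) (auto intro: finite_subset)
  then show ?thesis using assms(2) by (simp add: diag_len)
qed

lemma mem_boxes_iff_conj_len:
  assumes "young l" "1 \<le> i" "1 \<le> j"
  shows "(i, j) \<in> boxes l \<longleftrightarrow> i \<le> conj_len l j"
proof -
  have "i \<in> {i. (i, j) \<in> boxes l} \<longleftrightarrow> i \<in> Suc ` {i. i < length l \<and> j \<le> l ! i}" for i
    using assms(3) by (cases i) (auto simp: boxes_def)
  then have "{i. (i, j) \<in> boxes l} = Suc ` {i. i < length l \<and> j \<le> l ! i}"
    by blast
  then have conj_len: "conj_len l j = card {i. (i, j) \<in> boxes l}"
    by (simp add: conj_len_def length_filter_conv_card card_image)
  have "{i. (i, j) \<in> boxes l} \<subseteq> {1..length l}" by (auto simp: boxes_def)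
  then have "i \<in> {i. (i, j) \<in> boxes l} \<longleftrightarrow> 1 \<le> i \<and> i \<le> card {i. (i, j) \<in> boxes l}"
    using boxes_downward_closed[OF assms(1)] assms(3)
    by (intro mem_downward_closed_iff) (auto intro: finite_subset)
  then show ?thesis using assms(2) by (simp add: conj_len)
qed

lemma boxes_eq_Sigma_rows: "boxes l = Sigma {1..length l} (\<lambda>i. {1..row l (i - 1)})"
  by (auto simp: boxes_def row_def split: if_splits)

lemma sum_boxes_principal_hooks:
  assumes "young l"
  shows "(\<Sum>(i, j)\<in>boxes l. f i j)
    = (\<Sum>k=1..diag_len l. (\<Sum>j=k..row l (k - 1). f k j) + (\<Sum>i=Suc k..conj_len l k. f i k))"
proof -
  let ?arms = "Sigma {1..diag_len l} (\<lambda>k. {k..row l (k - 1)})"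
  let ?legs = "Sigma {1..diag_len l} (\<lambda>k. {Suc k..conj_len l k})"
  have diag: "k \<le> diag_len l" if "(i, j) \<in> boxes l" "1 \<le> k" "k \<le> i" "k \<le> j" for i j k
    using boxes_downward_closed[OF assms that(1,2,3) that(2,4)] diag_mem_boxes_iff[OF assms that(2)]
    by simp
  have arms: "{(i, j) \<in> boxes l. i \<le> j} = ?arms"
    using diag by (auto simp: mem_boxes_iff)
  have legs: "{(i, j) \<in> boxes l. \<not> i \<le> j} = prod.swap ` ?legs"
  proof (intro equalityI subsetI)
    fix p assume "p \<in> {(i, j) \<in> boxes l. \<not> i \<le> j}"
    then obtain i j where p: "p = (i, j)" "(i, j) \<in> boxes l" "j < i" by auto
    then have "1 \<le> i" "1 \<le> j" by (auto simp: mem_boxes_iff)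
    then have "(j, i) \<in> ?legs"
      using p diag[OF p(2), of j] mem_boxes_iff_conj_len[OF assms, of i j] by auto
    then show "p \<in> prod.swap ` ?legs" using p by force
  qed (use mem_boxes_iff_conj_len[OF assms] in auto)
  have "finite (boxes l)" by (simp add: boxes_eq_Sigma_rows)
  then have "(\<Sum>(i, j)\<in>boxes l. f i j)
      = (\<Sum>(i, j)\<in>{(i, j) \<in> boxes l. i \<le> j}. f i j) + (\<Sum>(i, j)\<in>{(i, j) \<in> boxes l. \<not> i \<le> j}. f i j)"
    using sum.Int_Diff[of "boxes l" "\<lambda>(i, j). f i j" "{(i, j). i \<le> j}"]
    by (simp add: Int_def set_diff_eq case_prod_unfold)
  also have "(\<Sum>(i, j)\<in>{(i, j) \<in> boxes l. \<not> i \<le> j}. f i j) = (\<Sum>(k, i)\<in>?legs. f i k)"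
    unfolding legs by (simp add: sum.reindex case_prod_unfold)
  finally show ?thesis unfolding arms
    by (simp add: sum.Sigma sum.distrib)
qed

lemma edge_sum_eq_sum_boxes:
  "edge_sum \<phi> l = (\<Sum>(i, j)\<in>boxes l. \<phi> (real j - real i + 1) - \<phi> (real j - real i))"
proof -
  have row: "(\<Sum>j=1..n. \<phi> (real j - real i + 1) - \<phi> (real j - real i))
      = \<phi> (real n - real i + 1) - \<phi> (1 - real i)" for n i
    by (induction n) (simp_all add: algebra_simps)
  have "(\<Sum>(i, j)\<in>boxes l. \<phi> (real j - real i + 1) - \<phi> (real j - real i))
      = (\<Sum>i=1..length l. \<phi> (real (row l (i - 1)) - real i + 1) - \<phi> (1 - real i))"
    unfolding boxes_eq_Sigma_rows row[symmetric] by (simp add: sum.Sigma)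
  also have "\<dots> = edge_sum \<phi> l"
    by (simp add: edge_sum_def edge_def sum.atLeast1_atMost_eq algebra_simps)
  finally show ?thesis by simp
qed

lemma edge_sum_frobenius:
  assumes "young l"
  shows "edge_sum \<phi> l = (\<Sum>k=1..diag_len l. \<phi> (frob_a l k + 1/2) - \<phi> (- frob_b l k + 1/2))"
  unfolding edge_sum_eq_sum_boxes sum_boxes_principal_hooks[OF assms]
proof (rule sum.cong)
  fix k assume k: "k \<in> {1..diag_len l}"
  then have box: "(k, k) \<in> boxes l" using diag_mem_boxes_iff[OF assms] by simp
  have arm: "(\<Sum>j=k..n. \<phi> (real j - real k + 1) - \<phi> (real j - real k)) = \<phi> (real n - real k + 1) - \<phi> 0"
    if "k \<le> n" for n
    using that by (induction n rule: dec_induct) (simp_all add: algebra_simps)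
  have leg: "(\<Sum>i=Suc k..n. \<phi> (real k - real i + 1) - \<phi> (real k - real i)) = \<phi> 0 - \<phi> (real k - real n)"
    if "k \<le> n" for n
    using that by (induction n rule: dec_induct) (simp_all add: algebra_simps)
  have "k \<le> row l (k - 1)" "k \<le> conj_len l k" "row l (k - 1) = l ! (k - 1)"
    using box k mem_boxes_iff_conj_len[OF assms, of k k] by (auto simp: mem_boxes_iff row_def)
  then show "(\<Sum>j=k..row l (k - 1). \<phi> (real j - real k + 1) - \<phi> (real j - real k))
      + (\<Sum>i=Suc k..conj_len l k. \<phi> (real k - real i + 1) - \<phi> (real k - real i))
      = \<phi> (frob_a l k + 1/2) - \<phi> (- frob_b l k + 1/2)"
    unfolding arm[OF \<open>k \<le> row l (k - 1)\<close>] leg[OF \<open>k \<le> conj_len l k\<close>]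
    by (simp add: frob_a_def frob_b_def algebra_simps)
qed simp

lemma psum_eq_edge_sum:
  assumes "1 \<le> k" "young l"
  shows "psum k l = edge_sum (\<lambda>x. (x - 1/2) ^ k) l"
proof -
  have "(-1) ^ (k - 1) * y ^ k = - ((- y) ^ k)" for y :: real
    using assms(1) by (cases k) (simp_all add: power_minus[of y])
  then show ?thesis by (simp add: psum_def edge_sum_frobenius[OF assms(2)])
qed

lemma psum_1: "young l \<Longrightarrow> psum 1 l = real (sum_list l)"
  using edge_sum_linear[of 1 "-1/2" l] by (simp add: psum_eq_edge_sum)

section \<open>Numbers of chains\<close>

lemma chains_altdef: "chains mu lam = {xs. xs \<noteq> [] \<and> hd xs = mu \<and> last xs = lam \<and>
    (\<forall>x\<in>set xs. young x) \<and> successively covers xs}"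
  by (auto simp: chains_def successively_conv_nth)

lemma snoc_in_chains_iff:
  assumes "young lam"
  shows "xs @ [x] \<in> chains mu lam \<longleftrightarrow>
    x = lam \<and> (xs = [] \<and> mu = lam \<or> (\<exists>rho. rho \<nearrow> lam \<and> xs \<in> chains mu rho))"
  using assms by (cases "xs = []") (auto simp: chains_altdef successively_append_iff)

lemma chains_eq_snoc:
  assumes "young lam"
  shows "chains mu lam = (if mu = lam then {[lam]} else {})
    \<union> (\<Union>rho\<in>{rho. rho \<nearrow> lam}. (\<lambda>xs. xs @ [lam]) ` chains mu rho)" (is "_ = ?R")
proof (rule set_eqI)
  fix xs
  have "[] \<notin> chains mu lam" by (simp add: chains_def)
  then show "xs \<in> chains mu lam \<longleftrightarrow> xs \<in> ?R"
    by (cases xs rule: rev_cases) (auto simp: snoc_in_chains_iff[OF assms])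
qed

lemma finite_chains: "young lam \<Longrightarrow> finite (chains mu lam)"
proof (induction "sum_list lam" arbitrary: lam rule: less_induct)
  case less
  have "finite (chains mu rho)" if "rho \<nearrow> lam" for rho
    using less.hyps[of rho] covers_sum_list[OF that] covers_youngD[OF that] by simp
  then show ?case
    unfolding chains_eq_snoc[OF less.prems]
    by (auto simp: covers_remove_box_eq[OF less.prems] covers_remove_box[OF less.prems])
qed

lemma dimr_recursion:
  assumes "young lam"
  shows "dimr mu lam = (\<Sum>i\<in>removable lam. dimr mu (remove_box lam i)) + (if mu = lam then 1 else 0)"
proof -
  let ?A = "if mu = lam then {[lam]} else {}"
  let ?B = "\<lambda>rho. (\<lambda>xs. xs @ [lam]) ` chains mu rho"
  have finite_covered: "finite {rho. rho \<nearrow> lam}" by (simp add: covers_remove_box_eq[OF assms])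
  have finite_B: "finite (?B rho)" if "rho \<nearrow> lam" for rho
    using finite_chains covers_youngD(1)[OF that] by blast
  have "dimr mu lam = card ?A + card (\<Union>rho\<in>{rho. rho \<nearrow> lam}. ?B rho)"
    unfolding dimr_def chains_eq_snoc[OF assms]
    by (rule card_Un_disjoint) (use finite_covered finite_B in \<open>auto simp: chains_def\<close>)
  also have "card (\<Union>rho\<in>{rho. rho \<nearrow> lam}. ?B rho) = (\<Sum>rho | rho \<nearrow> lam. card (?B rho))"
    by (rule card_UN_disjoint) (use finite_covered finite_B in \<open>auto simp: chains_def\<close>)
  also have "\<dots> = (\<Sum>rho | rho \<nearrow> lam. dimr mu rho)"
    by (auto simp: dimr_def inj_on_def intro!: sum.cong card_image)
  finally show ?thesis by (simp add: sum_covered[OF assms])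
qed

lemma removable_nonempty: "young l \<Longrightarrow> l \<noteq> [] \<Longrightarrow> length l - 1 \<in> removable l"
  using row_eq_0_iff[of l "length l - 1"] by (cases l) (auto simp: removable_def)

lemma dimY_pos: "young l \<Longrightarrow> 0 < dimY l"
proof (induction "sum_list l" arbitrary: l rule: less_induct)
  case less
  note recursion = dimr_recursion[OF less.prems, of "[]", folded dimY_def]
  show ?case
  proof (cases "l = []")
    case True
    then show ?thesis using recursion by simp
  next
    case False
    let ?i = "length l - 1"
    have i: "?i \<in> removable l" using removable_nonempty[OF less.prems False] .
    have "0 < dimY (remove_box l ?i)"
      by (rule less.hyps)
         (use Suc_sum_list_remove_box[OF less.prems i] young_remove_box[OF less.prems i] in auto)
    also have "\<dots> \<le> (\<Sum>i\<in>removable l. dimY (remove_box l i))"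
      using i by (intro member_le_sum) auto
    finally show ?thesis using recursion by simp
  qed
qed

definition add_sum :: "(real \<Rightarrow> real) \<Rightarrow> (nat list \<Rightarrow> real) \<Rightarrow> nat list \<Rightarrow> real" where
  "add_sum \<phi> g l = (\<Sum>i\<in>addable l. \<phi> (edge l i) * g (add_box l i))"

definition remove_sum :: "(real \<Rightarrow> real) \<Rightarrow> (nat list \<Rightarrow> real) \<Rightarrow> nat list \<Rightarrow> real" where
  "remove_sum \<phi> g l = (\<Sum>i\<in>removable l. \<phi> (edge l i - 1) * g (remove_box l i))"

lemma sum_add_then_remove_other:
  assumes "young l"
  shows "(\<Sum>i\<in>addable l. \<Sum>k\<in>removable (add_box l i) - {i}. \<phi> (edge l i) * g (remove_box (add_box l i) k))
    = (\<Sum>k\<in>removable l. \<Sum>i\<in>addable (remove_box l k) - {k}.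
        \<phi> (edge (remove_box l k) i) * g (add_box (remove_box l k) i))"
proof -
  let ?A = "Sigma (addable l) (\<lambda>i. removable (add_box l i) - {i})"
  let ?B = "Sigma (removable l) (\<lambda>k. addable (remove_box l k) - {k})"
  note exchange = addable_removable_exchange_iff[OF assms]
  have "(\<Sum>(i, k)\<in>?A. \<phi> (edge l i) * g (remove_box (add_box l i) k))
      = (\<Sum>(k, i)\<in>?B. \<phi> (edge (remove_box l k) i) * g (add_box (remove_box l k) i))"
  proof (rule sum.reindex_bij_witness[of _ prod.swap prod.swap])
    fix p assume "p \<in> ?A"
    then obtain i k where p: "p = (i, k)"
      and ik: "i \<noteq> k" "i \<in> addable l" "k \<in> removable (add_box l i)" by auto
    have k: "k \<in> removable l" "i \<in> addable (remove_box l k)" using exchange[OF ik(1)] ik(2,3) by blast+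
    show "prod.swap p \<in> ?B" using p ik(1) k by simp
    show "(case prod.swap p of (k, i) \<Rightarrow> \<phi> (edge (remove_box l k) i) * g (add_box (remove_box l k) i))
        = (case p of (i, k) \<Rightarrow> \<phi> (edge l i) * g (remove_box (add_box l i) k))"
      using p ik(1) by (simp add: remove_add_box_commute[OF assms ik] edge_remove_box[OF assms k(1)])
  next
    fix p assume "p \<in> ?B"
    then obtain k i where "p = (k, i)" "i \<noteq> k" "k \<in> removable l" "i \<in> addable (remove_box l k)" by auto
    then show "prod.swap p \<in> ?A" using exchange[of i k] by auto
  qed auto
  then show ?thesis by (simp add: sum.Sigma)
qed

text \<open>Adding a box and then removing another one commutes with removing first; only the pairs in which
  the added box is removed again differ.\<close>
lemma add_sum_remove_sum_commutator:
  assumes "young l"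
  shows "add_sum \<phi> (remove_sum (\<lambda>_. 1) g) l
    = remove_sum (\<lambda>_. 1) (add_sum \<phi> g) l + interlacing_sum \<phi> l * g l"
proof -
  have "remove_sum (\<lambda>_. 1) g (add_box l i)
      = g l + (\<Sum>k\<in>removable (add_box l i) - {i}. g (remove_box (add_box l i) k))"
    if "i \<in> addable l" for i
    using remove_add_box[OF assms that] by (simp add: remove_sum_def sum.remove[of _ i])
  then have "add_sum \<phi> (remove_sum (\<lambda>_. 1) g) l = (\<Sum>i\<in>addable l. \<phi> (edge l i)) * g l
      + (\<Sum>i\<in>addable l. \<Sum>k\<in>removable (add_box l i) - {i}. \<phi> (edge l i) * g (remove_box (add_box l i) k))"
    by (simp add: add_sum_def distrib_left sum.distrib sum_distrib_left sum_distrib_right)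
  moreover have "add_sum \<phi> g (remove_box l k) = \<phi> (edge l k - 1) * g l
      + (\<Sum>i\<in>addable (remove_box l k) - {k}. \<phi> (edge (remove_box l k) i) * g (add_box (remove_box l k) i))"
    if "k \<in> removable l" for k
    using add_remove_box[OF assms that]
    by (simp add: add_sum_def sum.remove[of _ k] edge_remove_box[OF assms that] del: fun_upd_apply) simp
  then have "remove_sum (\<lambda>_. 1) (add_sum \<phi> g) l = (\<Sum>k\<in>removable l. \<phi> (edge l k - 1)) * g l
      + (\<Sum>k\<in>removable l. \<Sum>i\<in>addable (remove_box l k) - {k}.
          \<phi> (edge (remove_box l k) i) * g (add_box (remove_box l k) i))"
    by (simp add: remove_sum_def sum.distrib sum_distrib_right)
  ultimately show ?thesis
    unfolding sum_add_then_remove_other[OF assms] by (simp add: interlacing_sum_def algebra_simps)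
qed

lemma add_sum_indicator:
  assumes "young l" "young mu"
  shows "add_sum \<phi> (\<lambda>nu. if mu = nu then 1 else 0) l = remove_sum \<phi> (\<lambda>nu. if nu = l then 1 else 0) mu"
proof (cases "\<exists>k\<in>addable l. mu = add_box l k")
  case True
  then obtain k where k: "k \<in> addable l" "mu = add_box l k" by blast
  note k' = remove_add_box[OF assms(1) k(1), folded k(2)]
  have "add_sum \<phi> (\<lambda>nu. if mu = nu then 1 else 0) l = (\<Sum>i\<in>addable l. if i = k then \<phi> (edge l i) else 0)"
    unfolding add_sum_def
    by (rule sum.cong) (use k inj_on_add_box[OF assms(1)] in \<open>auto simp: inj_on_def\<close>)
  moreover have "remove_sum \<phi> (\<lambda>nu. if nu = l then 1 else 0) mu
      = (\<Sum>j\<in>removable mu. if j = k then \<phi> (edge mu j - 1) else 0)"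
    unfolding remove_sum_def
    by (rule sum.cong) (use k' inj_on_remove_box[OF assms(2)] in \<open>auto simp: inj_on_def\<close>)
  ultimately show ?thesis using k k' by (simp add: edge_add_box[OF assms(1)])
next
  case False
  have "remove_box mu j \<noteq> l" if "j \<in> removable mu" for j
    using add_remove_box[OF assms(2) that] False by auto
  then show ?thesis using False by (simp add: add_sum_def remove_sum_def)
qed

lemma dimr_remove_sum_recursion:
  "young nu \<Longrightarrow> real (dimr mu nu)
    = remove_sum (\<lambda>_. 1) (\<lambda>rho. real (dimr mu rho)) nu + (if mu = nu then 1 else 0)"
  by (simp add: dimr_recursion remove_sum_def)

lemma remove_sum_dimr_recursion:
  assumes "young l"
  shows "remove_sum \<phi> (\<lambda>nu. real (dimr nu l)) mu
    = remove_sum (\<lambda>_. 1) (\<lambda>rho. remove_sum \<phi> (\<lambda>nu. real (dimr nu rho)) mu) l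
      + remove_sum \<phi> (\<lambda>nu. if nu = l then 1 else 0) mu"
  unfolding dimr_remove_sum_recursion[OF assms]
  by (simp add: remove_sum_def distrib_left sum.distrib sum_distrib_left sum.swap[of _ "removable l"])

lemma add_sum_dimr:
  assumes interlacing: "\<And>l. young l \<Longrightarrow> interlacing_sum \<phi> l = a + 2 * real (sum_list l)"
    and mu: "young mu" and l: "young l"
  shows "add_sum \<phi> (\<lambda>nu. real (dimr mu nu)) l = remove_sum \<phi> (\<lambda>nu. real (dimr nu l)) mu
    + (real (sum_list l) - real (sum_list mu) + 1) * (a + real (sum_list l) + real (sum_list mu))
      * real (dimr mu l)"
  using l
proof (induction "sum_list l" arbitrary: l rule: less_induct)
  case less
  note l = less.prems
  define n m where "n = real (sum_list l)" and "m = real (sum_list mu)"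
  let ?d = "\<lambda>nu. real (dimr mu nu)" and ?\<delta> = "\<lambda>nu. if mu = nu then 1 else 0 :: real"
  have "add_sum \<phi> ?d l = add_sum \<phi> (remove_sum (\<lambda>_. 1) ?d) l + add_sum \<phi> ?\<delta> l"
    unfolding add_sum_def
    by (simp add: dimr_remove_sum_recursion young_add_box[OF l] distrib_left sum.distrib)
  also have "\<dots> = remove_sum (\<lambda>_. 1) (add_sum \<phi> ?d) l + (a + 2 * n) * ?d l
      + remove_sum \<phi> (\<lambda>nu. if nu = l then 1 else 0) mu"
    by (simp add: add_sum_remove_sum_commutator[OF l] add_sum_indicator[OF l mu]
        interlacing[OF l] n_def)
  also have "remove_sum (\<lambda>_. 1) (add_sum \<phi> ?d) l
      = remove_sum (\<lambda>_. 1) (\<lambda>rho. remove_sum \<phi> (\<lambda>nu. real (dimr nu rho)) mu) l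
        + (n - m) * (a + n + m - 1) * remove_sum (\<lambda>_. 1) ?d l"
  proof -
    have "add_sum \<phi> ?d (remove_box l k) = remove_sum \<phi> (\<lambda>nu. real (dimr nu (remove_box l k))) mu
        + (n - m) * (a + n + m - 1) * ?d (remove_box l k)" if k: "k \<in> removable l" for k
    proof -
      have size: "real (sum_list (remove_box l k)) = n - 1"
        using Suc_sum_list_remove_box[OF l k] by (simp add: n_def)
      show ?thesis
        using less.hyps[OF _ young_remove_box[OF l k]] Suc_sum_list_remove_box[OF l k]
        unfolding size by (simp add: m_def algebra_simps)
    qed
    then show ?thesis by (simp add: remove_sum_def sum.distrib sum_distrib_left)
  qed
  also have "(n - m) * (a + n + m - 1) * remove_sum (\<lambda>_. 1) ?d l = (n - m) * (a + n + m - 1) * ?d l"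
    using dimr_remove_sum_recursion[OF l, of mu] by (cases "mu = l") (simp_all add: n_def m_def)
  finally have "add_sum \<phi> ?d l = remove_sum \<phi> (\<lambda>nu. real (dimr nu l)) mu
      + (n - m) * (a + n + m - 1) * ?d l + (a + 2 * n) * ?d l"
    unfolding remove_sum_dimr_recursion[OF l, of \<phi> mu] by simp
  then show ?case by (simp add: n_def m_def algebra_simps)
qed

section \<open>Transition weights\<close>

text \<open>Kerov's formulas, with the products running over the first rows of \<open>l\<close> instead of its corners:
  the factors of the remaining rows cancel.\<close>
definition up_weight :: "nat \<Rightarrow> nat list \<Rightarrow> nat \<Rightarrow> real" where
  "up_weight N l = ratio_residue (\<lambda>j. edge l j - 1) {..<N} (edge l) {..<Suc N}"

definition down_weight :: "nat \<Rightarrow> nat list \<Rightarrow> nat \<Rightarrow> real" where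
  "down_weight N l i = - ratio_residue (edge l) {..<Suc N} (\<lambda>j. edge l j - 1) {..<N} i"

definition up_series :: "nat \<Rightarrow> nat list \<Rightarrow> real fps" where
  "up_series N l = ratio_series (\<lambda>j. edge l j - 1) {..<N} (edge l) {..<Suc N}"

definition down_series :: "nat \<Rightarrow> nat list \<Rightarrow> real fps" where
  "down_series N l = ratio_series (edge l) {..<Suc N} (\<lambda>j. edge l j - 1) {..<N}"

lemma up_weight_not_addable:
  assumes "young l" "i \<le> N" "i \<notin> addable l"
  shows "up_weight N l i = 0"
proof -
  obtain k where k: "i = Suc k" "k \<notin> removable l"
    using assms(3) by (cases i) (auto simp: addable_eq_removable)
  then have "(\<Prod>j<N. edge l i - (edge l j - 1)) = 0"
    using assms(2) edge_Suc_not_removable[OF assms(1) k(2)] by (intro prod_zero) auto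
  then show ?thesis by (simp add: up_weight_def ratio_residue_def)
qed

lemma down_weight_not_removable:
  assumes "young l" "i < N" "i \<notin> removable l"
  shows "down_weight N l i = 0"
proof -
  have "(\<Prod>j<Suc N. edge l i - 1 - edge l j) = 0"
    using assms(2) edge_Suc_not_removable[OF assms(1,3)]
    by (intro prod_zero) (auto intro!: bexI[of _ "Suc i"])
  then show ?thesis by (simp add: down_weight_def ratio_residue_def)
qed

lemma sum_up_weight_power:
  assumes "young l" "length l \<le> N"
  shows "(\<Sum>i\<in>addable l. up_weight N l i * edge l i ^ k) = fps_nth (up_series N l) k"
proof -
  have "(\<Sum>i\<in>addable l. up_weight N l i * edge l i ^ k) = (\<Sum>i<Suc N. up_weight N l i * edge l i ^ k)"
    by (rule sum.mono_neutral_left)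
       (use assms up_weight_not_addable[OF assms(1)] in \<open>auto dest!: addable_le_length\<close>)
  also have "\<dots> = fps_nth (up_series N l) k"
    unfolding up_weight_def up_series_def
    by (subst sum_ratio_residue_power) (auto intro: inj_on_subset[OF inj_edge[OF assms(1)]])
  finally show ?thesis .
qed

lemma sum_down_weight_power:
  assumes "young l" "length l \<le> N" "0 < N"
  shows "(\<Sum>i\<in>removable l. down_weight N l i * (edge l i - 1) ^ k) = - fps_nth (down_series N l) (k + 2)"
proof -
  have "inj_on (\<lambda>j. edge l j - 1) {..<N}"
    using inj_on_subset[OF inj_edge[OF assms(1)]] by (auto simp: inj_on_def)
  then have "(\<Sum>i<N. down_weight N l i * (edge l i - 1) ^ k) = - fps_nth (down_series N l) (k + 2)"
    using sum_ratio_residue_power[of "{..<N}" "\<lambda>j. edge l j - 1" "{..<Suc N}" k "edge l"] assms(3)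
    by (auto simp: down_weight_def down_series_def sum_negf)
  moreover have "(\<Sum>i\<in>removable l. down_weight N l i * (edge l i - 1) ^ k)
      = (\<Sum>i<N. down_weight N l i * (edge l i - 1) ^ k)"
    by (rule sum.mono_neutral_left)
       (use assms down_weight_not_removable[OF assms(1)] in \<open>auto dest!: removable_less_length\<close>)
  ultimately show ?thesis by simp
qed

lemma up_series_newton:
  assumes "young l" "length l \<le> N"
  shows "real k * fps_nth (up_series N l) k
    = (\<Sum>r<k. fps_nth (up_series N l) r * interlacing_sum (\<lambda>x. x ^ (k - r)) l)"
  unfolding up_series_def interlacing_sum_rows[OF assms] by (rule ratio_series_newton)

lemma down_series_newton:
  assumes "young l" "length l \<le> N"
  shows "real k * fps_nth (down_series N l) k
    = (\<Sum>r<k. fps_nth (down_series N l) r * - interlacing_sum (\<lambda>x. x ^ (k - r)) l)"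
  unfolding down_series_def interlacing_sum_rows[OF assms] minus_diff_eq by (rule ratio_series_newton)

lemma sum_down_weight:
  assumes "young l" "length l \<le> N" "0 < N"
  shows "(\<Sum>i\<in>removable l. down_weight N l i) = real (sum_list l)"
proof -
  have "interlacing_sum (\<lambda>x. x ^ 1) l = 0"
    using edge_sum_linear[of 0 1 l] by (simp add: interlacing_sum_eq_edge_sum[OF assms(1)])
  moreover have "interlacing_sum (\<lambda>x. x ^ 2) l = 2 * real (sum_list l)"
    using interlacing_sum_quadratic[OF assms(1), of 0 0] by simp
  ultimately have "fps_nth (down_series N l) 2 = - real (sum_list l)"
    using down_series_newton[OF assms(1,2), of 2] by (simp add: numeral_2_eq_2 down_series_def)
  then show ?thesis using sum_down_weight_power[OF assms, of 0] by (simp add: numeral_2_eq_2)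
qed

lemma vandermonde_edge_remove_box:
  assumes "young l" "length l \<le> N" "i \<in> removable l"
  shows "vandermonde N (edge (remove_box l i)) * (edge l i + real N - 1)
    = down_weight N l i * vandermonde N (edge l)"
proof -
  have i: "i < N" using removable_less_length[OF assms(3)] assms(2) by simp
  let ?D = "\<Prod>j\<in>{..<N} - {i}. edge l i - edge l j"
  let ?P = "\<Prod>j\<in>{..<N} - {i}. edge l i - 1 - edge l j"
  have "(\<Prod>j<Suc N. edge l i - 1 - edge l j) = - (?P * (edge l i + real N - 1))"
    using i assms(2) by (simp add: prod.remove[of "{..<N}" i] edge_beyond_length mult.commute)
  then have weight: "down_weight N l i = ?P * (edge l i + real N - 1) / ?D"
    by (simp add: down_weight_def ratio_residue_def)
  have "?D \<noteq> 0" using inj_edge[OF assms(1)] by (auto simp: inj_eq)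
  moreover have "vandermonde N (edge (remove_box l i)) * ?D = vandermonde N (edge l) * ?P"
    unfolding edge_remove_box[OF assms(1,3)] by (rule vandermonde_fun_upd[OF i])
  ultimately show ?thesis unfolding weight by (simp add: field_simps)
qed

lemma vandermonde_edge_Nil: "vandermonde N (edge []) = (\<Prod>i<N. fact (N - Suc i))"
proof -
  have "(\<Prod>i<j. edge [] i - edge [] j) = fact j" for j
  proof -
    have "(\<Prod>i<j. edge [] i - edge [] j) = (\<Prod>i<j. real (j - i))"
      by (rule prod.cong) (simp_all add: edge_def of_nat_diff)
    then show ?thesis by (simp add: fact_prod_rev atLeast0LessThan)
  qed
  then have "vandermonde N (edge []) = (\<Prod>j<N. fact j)" by (simp add: vandermonde_def)
  then show ?thesis by (simp add: prod.nat_diff_reindex)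
qed

definition row_factorials :: "nat \<Rightarrow> nat list \<Rightarrow> real" where
  "row_factorials N l = (\<Prod>i<N. fact (row l i + (N - Suc i)))"

lemma row_factorials_nonzero: "row_factorials N l \<noteq> 0"
  by (simp add: row_factorials_def)

lemma row_factorials_remove_box:
  assumes "young l" "length l \<le> N" "i \<in> removable l"
  shows "row_factorials N l = (edge l i + real N - 1) * row_factorials N (remove_box l i)"
proof -
  have i: "i < N" using removable_less_length[OF assms(3)] assms(2) by simp
  obtain r where r: "row l i = Suc r" using assms(3) by (cases "row l i") (auto simp: removable_def)
  have "row_factorials N (remove_box l i)
      = fact (r + (N - Suc i)) * (\<Prod>j\<in>{..<N} - {i}. fact (row l j + (N - Suc j)))"
    using i r by (simp add: row_factorials_def prod.remove[of "{..<N}" i] row_remove_box[OF assms(1,3)])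
  moreover have "row_factorials N l
      = fact (Suc r + (N - Suc i)) * (\<Prod>j\<in>{..<N} - {i}. fact (row l j + (N - Suc j)))"
    using i by (simp only: row_factorials_def prod.remove[of "{..<N}" i] r finite_lessThan lessThan_iff)
  moreover have "edge l i + real N - 1 = real (Suc (r + (N - Suc i)))"
    using i by (simp add: edge_def r of_nat_diff)
  ultimately show ?thesis by (simp only: add_Suc fact_Suc mult.assoc)
qed

theorem frobenius_dimension_formula:
  assumes "young l" "length l \<le> N" "0 < N"
  shows "real (dimY l) * row_factorials N l = fact (sum_list l) * vandermonde N (edge l)"
  using assms(1,2)
proof (induction "sum_list l" arbitrary: l rule: less_induct)
  case less
  note l = less.prems
  note recursion = dimr_recursion[OF l(1), of "[]", folded dimY_def]
  show ?case
  proof (cases "l = []")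
    case True
    have "dimY [] = 1" using recursion unfolding True by (simp add: removable_def)
    then show ?thesis using True by (simp add: vandermonde_edge_Nil row_factorials_def)
  next
    case False
    obtain n where n: "sum_list l = Suc n"
      using Suc_sum_list_remove_box[OF l(1) removable_nonempty[OF l(1) False]] by metis
    have "real (dimY (remove_box l i)) * row_factorials N l
        = fact n * (down_weight N l i * vandermonde N (edge l))"
      if i: "i \<in> removable l" for i
    proof -
      have "sum_list (remove_box l i) = n" using Suc_sum_list_remove_box[OF l(1) i] n by simp
      moreover have "real (dimY (remove_box l i)) * row_factorials N (remove_box l i)
          = fact (sum_list (remove_box l i)) * vandermonde N (edge (remove_box l i))"
        by (rule less.hyps)
           (use n calculation young_remove_box[OF l(1) i] length_remove_box_le[OF l(1) i] l(2) in auto)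
      ultimately show ?thesis
        unfolding row_factorials_remove_box[OF l i] vandermonde_edge_remove_box[OF l i, symmetric]
        by (simp add: mult_ac)
    qed
    then have "real (dimY l) * row_factorials N l
        = fact n * (\<Sum>i\<in>removable l. down_weight N l i) * vandermonde N (edge l)"
      using False by (simp add: recursion sum_distrib_left sum_distrib_right mult.assoc)
    then show ?thesis by (simp add: sum_down_weight[OF l assms(3)] n mult_ac)
  qed
qed

lemma dimY_remove_box:
  assumes "young l" "length l \<le> N" "i \<in> removable l"
  shows "real (sum_list l) * real (dimY (remove_box l i)) = down_weight N l i * real (dimY l)"
proof -
  let ?l = "remove_box l i"
  have N: "0 < N" using removable_less_length[OF assms(3)] assms(2) by simp
  have size: "sum_list l = Suc (sum_list ?l)" using Suc_sum_list_remove_box[OF assms(1,3)] by simp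
  have formula: "real (dimY ?l) * row_factorials N ?l = fact (sum_list ?l) * vandermonde N (edge ?l)"
    using frobenius_dimension_formula[OF young_remove_box[OF assms(1,3)] _ N]
      length_remove_box_le[OF assms(1,3)] assms(2) by simp
  have "real (sum_list l) * real (dimY ?l) * row_factorials N l
      = fact (sum_list l) * (vandermonde N (edge ?l) * (edge l i + real N - 1))"
    using formula by (simp add: row_factorials_remove_box[OF assms] size mult_ac)
  also have "\<dots> = down_weight N l i * (real (dimY l) * row_factorials N l)"
    unfolding vandermonde_edge_remove_box[OF assms] frobenius_dimension_formula[OF assms(1,2) N]
    by simp
  finally show ?thesis using row_factorials_nonzero[of N l] by simp
qed

lemma up_weight_mult_down_weight:
  assumes "young l" "length l < N" "i \<in> addable l"
  shows "up_weight N l i * down_weight N (add_box l i) i = 1"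
proof -
  have i: "i < N" using addable_le_length[OF assms(3)] assms(2) by simp
  let ?A = "\<Prod>j\<in>{..<Suc N} - {i}. edge l i - edge l j"
  let ?B = "\<Prod>j\<in>{..<N} - {i}. edge l i + 1 - edge l j"
  have "(\<Prod>j<N. edge l i - (edge l j - 1)) = ?B"
    using i by (simp add: prod.remove[of "{..<N}" i] algebra_simps)
  then have up: "up_weight N l i = ?B / ?A"
    by (simp add: up_weight_def ratio_residue_def)
  have "(\<Prod>j<Suc N. edge (add_box l i) i - 1 - edge (add_box l i) j) = - ?A"
    unfolding edge_add_box[OF assms(1,3)] using i by (subst prod.remove[of _ i]) auto
  moreover have "(\<Prod>j\<in>{..<N} - {i}. edge (add_box l i) i - 1 - (edge (add_box l i) j - 1)) = ?B"
    unfolding edge_add_box[OF assms(1,3)] by (rule prod.cong) auto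
  ultimately have down: "down_weight N (add_box l i) i = ?A / ?B"
    by (simp add: down_weight_def ratio_residue_def)
  have "?A \<noteq> 0" using inj_edge[OF assms(1)] by (auto simp: inj_eq)
  moreover have "?B \<noteq> 0"
  proof -
    have "edge (add_box l i) i \<noteq> edge (add_box l i) j" if "j \<noteq> i" for j
      using inj_edge[OF young_add_box[OF assms(1,3)]] that by (simp add: inj_eq)
    then show ?thesis unfolding edge_add_box[OF assms(1,3)] by auto
  qed
  ultimately show ?thesis unfolding up down by simp
qed

lemma dimY_add_box:
  assumes "young l" "length l < N" "i \<in> addable l"
  shows "real (dimY (add_box l i)) = up_weight N l i * (real (Suc (sum_list l)) * real (dimY l))"
proof -
  note removable = remove_add_box[OF assms(1,3)]
  have "real (sum_list (add_box l i)) * real (dimY (remove_box (add_box l i) i))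
      = down_weight N (add_box l i) i * real (dimY (add_box l i))"
    by (rule dimY_remove_box)
       (use removable young_add_box[OF assms(1,3)] length_add_box_le[OF assms(1,3)] assms(2) in auto)
  then have "real (Suc (sum_list l)) * real (dimY l)
      = down_weight N (add_box l i) i * real (dimY (add_box l i))"
    by (simp only: removable sum_list_add_box[OF assms(1,3)])
  then show ?thesis
    using up_weight_mult_down_weight[OF assms] by (metis mult.assoc mult_1)
qed

section \<open>Elements of the algebra\<close>

definition in_Lam :: "(nat list \<Rightarrow> real) \<Rightarrow> bool" where
  "in_Lam f \<longleftrightarrow> (\<lambda>l. if young l then f l else 0) \<in> Lam"

lemma Lam_not_young: "f \<in> Lam \<Longrightarrow> \<not> young l \<Longrightarrow> f l = 0"
  by (induction rule: Lam.induct) auto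

lemma in_LamD:
  assumes "in_Lam f" "\<And>l. \<not> young l \<Longrightarrow> f l = 0"
  shows "f \<in> Lam"
proof -
  have "(\<lambda>l. if young l then f l else 0) = f" using assms(2) by auto
  then show ?thesis using assms(1) by (simp add: in_Lam_def)
qed

lemma in_Lam_cong: "in_Lam g \<Longrightarrow> (\<And>l. young l \<Longrightarrow> f l = g l) \<Longrightarrow> in_Lam f"
  unfolding in_Lam_def by (auto cong: if_cong)

lemma in_Lam_const: "in_Lam (\<lambda>l. c)"
  unfolding in_Lam_def by (rule Lam.const)

lemma in_Lam_add: "in_Lam f \<Longrightarrow> in_Lam g \<Longrightarrow> in_Lam (\<lambda>l. f l + g l)"
  unfolding in_Lam_def by (drule (1) Lam.add) (simp add: if_distrib if_distribR cong: if_cong)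

lemma in_Lam_mult: "in_Lam f \<Longrightarrow> in_Lam g \<Longrightarrow> in_Lam (\<lambda>l. f l * g l)"
  unfolding in_Lam_def by (drule (1) Lam.mult) (simp add: if_distrib if_distribR cong: if_cong)

lemma in_Lam_uminus: "in_Lam f \<Longrightarrow> in_Lam (\<lambda>l. - f l)"
  using in_Lam_mult[OF in_Lam_const[of "-1"]] by fastforce

lemma in_Lam_sum: "(\<And>a. a \<in> A \<Longrightarrow> in_Lam (f a)) \<Longrightarrow> in_Lam (\<lambda>l. \<Sum>a\<in>A. f a l)"
  by (induction A rule: infinite_finite_induct) (auto intro: in_Lam_const in_Lam_add)

lemma in_Lam_edge_sum_poly: "in_Lam (edge_sum (poly p))"
proof -
  define q where "q = pcompose p [:1/2, 1:]"
  have "poly p x = (\<Sum>k\<le>degree q. coeff q k * (x - 1/2) ^ k)" for x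
    using poly_altdef[of q "x - 1/2"] by (simp add: q_def poly_pcompose)
  then have expand: "poly p = (\<lambda>x. \<Sum>k\<le>degree q. coeff q k * (x - 1/2) ^ k)" by (rule ext)
  have "edge_sum (poly p) = (\<lambda>l. \<Sum>k\<le>degree q. coeff q k * edge_sum (\<lambda>x. (x - 1/2) ^ k) l)"
    unfolding expand by (intro ext) (simp only: edge_sum_sum edge_sum_cmult)
  moreover have "in_Lam (edge_sum (\<lambda>x. (x - 1/2) ^ k))" for k
  proof (cases "k = 0")
    case True
    then show ?thesis using in_Lam_const[of 0] by (simp add: edge_sum_def[abs_def])
  next
    case False
    then have "in_Lam (psum k)" unfolding in_Lam_def by (intro Lam.gen) simp
    then show ?thesis by (rule in_Lam_cong) (use False in \<open>simp add: psum_eq_edge_sum\<close>)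
  qed
  ultimately show ?thesis
    by (simp only:) (intro in_Lam_sum in_Lam_mult in_Lam_const)
qed

lemma in_Lam_interlacing_sum_power: "in_Lam (interlacing_sum (\<lambda>x. x ^ k))"
proof -
  have "poly (monom 1 k - pcompose (monom 1 k) [:-1, 1:]) = (\<lambda>x :: real. x ^ k - (x - 1) ^ k)"
    by (simp add: fun_eq_iff poly_pcompose poly_monom)
  then have "in_Lam (\<lambda>l. 0 ^ k + edge_sum (\<lambda>x. x ^ k - (x - 1) ^ k) l)"
    using in_Lam_add[OF in_Lam_const in_Lam_edge_sum_poly] by metis
  then show ?thesis by (rule in_Lam_cong) (rule interlacing_sum_eq_edge_sum)
qed

lemma in_Lam_newton:
  assumes h: "\<And>k. in_Lam (h k)"
    and init: "\<And>l. young l \<Longrightarrow> g 0 l = 1"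
    and step: "\<And>k l. young l \<Longrightarrow> real k * g k l = (\<Sum>r<k. g r l * h (k - r) l)"
  shows "in_Lam (g k)"
proof (induction k rule: less_induct)
  case (less k)
  show ?case
  proof (cases "k = 0")
    case True
    show ?thesis by (rule in_Lam_cong[OF in_Lam_const[of 1]]) (simp add: True init)
  next
    case False
    have "in_Lam (\<lambda>l. (1 / real k) * (\<Sum>r<k. g r l * h (k - r) l))"
      by (intro in_Lam_mult in_Lam_const in_Lam_sum h less.IH) simp
    then show ?thesis
      by (rule in_Lam_cong) (use False in \<open>simp add: step[symmetric]\<close>)
  qed
qed

lemma in_Lam_up_moment: "in_Lam (\<lambda>l. \<Sum>i\<in>addable l. up_weight (Suc (length l)) l i * edge l i ^ k)"
proof -
  have "in_Lam (\<lambda>l. fps_nth (up_series (Suc (length l)) l) k)"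
    by (rule in_Lam_newton[OF in_Lam_interlacing_sum_power])
       (simp_all add: up_series_newton, simp add: up_series_def)
  then show ?thesis by (rule in_Lam_cong) (simp add: sum_up_weight_power)
qed

lemma in_Lam_down_moment:
  "in_Lam (\<lambda>l. \<Sum>i\<in>removable l. down_weight (Suc (length l)) l i * (edge l i - 1) ^ k)"
proof -
  have "in_Lam (\<lambda>l. fps_nth (down_series (Suc (length l)) l) k)" for k
    by (rule in_Lam_newton[OF in_Lam_uminus[OF in_Lam_interlacing_sum_power]])
       (simp_all add: down_series_newton, simp add: down_series_def)
  then have "in_Lam (\<lambda>l. - fps_nth (down_series (Suc (length l)) l) (k + 2))"
    by (rule in_Lam_uminus)
  then show ?thesis by (rule in_Lam_cong) (simp add: sum_down_weight_power)
qed

inductive_set Lam_poly :: "(nat list \<Rightarrow> real \<Rightarrow> real) set" where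
  monomial: "in_Lam g \<Longrightarrow> (\<lambda>l x. g l * x ^ k) \<in> Lam_poly"
| add: "F \<in> Lam_poly \<Longrightarrow> G \<in> Lam_poly \<Longrightarrow> (\<lambda>l x. F l x + G l x) \<in> Lam_poly"

lemma Lam_poly_const: "in_Lam g \<Longrightarrow> (\<lambda>l x. g l) \<in> Lam_poly"
  using Lam_poly.monomial[of g 0] by simp

lemma Lam_poly_mult:
  assumes "F \<in> Lam_poly" "G \<in> Lam_poly"
  shows "(\<lambda>l x. F l x * G l x) \<in> Lam_poly"
  using assms(1)
proof (induction rule: Lam_poly.induct)
  case (monomial g k)
  from assms(2) show ?case
  proof (induction rule: Lam_poly.induct)
    case (monomial h m)
    have "(\<lambda>l x. (g l * h l) * x ^ (k + m)) \<in> Lam_poly"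
      by (intro Lam_poly.monomial in_Lam_mult \<open>in_Lam g\<close> \<open>in_Lam h\<close>)
    then show ?case by (simp add: power_add mult_ac)
  next
    case (add F G)
    then show ?case using Lam_poly.add by (fastforce simp: algebra_simps)
  qed
next
  case (add F H)
  then show ?case using Lam_poly.add by (fastforce simp: algebra_simps)
qed

lemma Lam_poly_poly: "(\<lambda>l. poly p) \<in> Lam_poly"
proof (induction p)
  case 0
  show ?case using Lam_poly_const[OF in_Lam_const[of 0]] by simp
next
  case (pCons a p)
  have "(\<lambda>l x. a + (1 * x ^ 1) * poly p x) \<in> Lam_poly"
    by (intro Lam_poly.add Lam_poly_mult Lam_poly_const Lam_poly.monomial in_Lam_const pCons.IH)
  then show ?case by simp
qed

text \<open>Covers adding a box (\<open>s = 1\<close>) and removing one (\<open>s = -1\<close>) of content \<open>c l i\<close>.\<close>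
lemma Lam_move_box:
  assumes "f \<in> Lam"
    and young: "\<And>l i. young l \<Longrightarrow> i \<in> R l \<Longrightarrow> young (T l i)"
    and move: "\<And>\<phi> l i. young l \<Longrightarrow> i \<in> R l \<Longrightarrow>
      edge_sum \<phi> (T l i) = edge_sum \<phi> l + s * (\<phi> (c l i + 1) - \<phi> (c l i))"
  shows "\<exists>F\<in>Lam_poly. \<forall>l. young l \<longrightarrow> (\<forall>i\<in>R l. f (T l i) = F l (c l i))"
  using assms(1)
proof (induction rule: Lam.induct)
  case (const a)
  show ?case
    by (rule bexI[OF _ Lam_poly_const[OF in_Lam_const[of a]]]) (simp add: young)
next
  case (gen k)
  define q :: "real poly" where "q = smult s ([:1/2, 1:] ^ k - [:-1/2, 1:] ^ k)"
  have "poly ([:-1/2, 1:] ^ k) = (\<lambda>x :: real. (x - 1/2) ^ k)"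
    by (simp add: fun_eq_iff poly_power)
  then have "in_Lam (edge_sum (\<lambda>x. (x - 1/2) ^ k))"
    by (metis in_Lam_edge_sum_poly)
  then have "(\<lambda>l x. edge_sum (\<lambda>x. (x - 1/2) ^ k) l + poly q x) \<in> Lam_poly"
    by (intro Lam_poly.add Lam_poly_const Lam_poly_poly)
  moreover have "psum k (T l i) = edge_sum (\<lambda>x. (x - 1/2) ^ k) l + poly q (c l i)"
    if "young l" "i \<in> R l" for l i
    by (simp add: psum_eq_edge_sum[OF gen young[OF that]] move[OF that] q_def poly_power algebra_simps)
  ultimately show ?case using young by (auto intro!: bexI)
next
  case (add f g)
  then obtain F G where "F \<in> Lam_poly" "G \<in> Lam_poly"
    "\<forall>l. young l \<longrightarrow> (\<forall>i\<in>R l. f (T l i) = F l (c l i))"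
    "\<forall>l. young l \<longrightarrow> (\<forall>i\<in>R l. g (T l i) = G l (c l i))" by blast
  then show ?case by (intro bexI[of _ "\<lambda>l x. F l x + G l x"]) (auto intro: Lam_poly.add)
next
  case (mult f g)
  then obtain F G where "F \<in> Lam_poly" "G \<in> Lam_poly"
    "\<forall>l. young l \<longrightarrow> (\<forall>i\<in>R l. f (T l i) = F l (c l i))"
    "\<forall>l. young l \<longrightarrow> (\<forall>i\<in>R l. g (T l i) = G l (c l i))" by blast
  then show ?case by (intro bexI[of _ "\<lambda>l x. F l x * G l x"]) (auto intro: Lam_poly_mult)
qed

lemma in_Lam_weighted_sum:
  assumes "F \<in> Lam_poly" and moment: "\<And>k. in_Lam (\<lambda>l. \<Sum>i\<in>A l. w l i * c l i ^ k)"
  shows "in_Lam (\<lambda>l. \<Sum>i\<in>A l. w l i * F l (c l i))"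
  using assms(1)
proof (induction rule: Lam_poly.induct)
  case (monomial g k)
  then have "in_Lam (\<lambda>l. g l * (\<Sum>i\<in>A l. w l i * c l i ^ k))" by (rule in_Lam_mult[OF _ moment])
  then show ?case by (simp add: sum_distrib_left mult.left_commute)
next
  case (add F G)
  then have "in_Lam (\<lambda>l. (\<Sum>i\<in>A l. w l i * F l (c l i)) + (\<Sum>i\<in>A l. w l i * G l (c l i)))"
    by (intro in_Lam_add)
  then show ?case by (simp add: distrib_left sum.distrib)
qed

lemma in_Lam_up_average:
  assumes "f \<in> Lam" "G \<in> Lam_poly"
  shows "in_Lam (\<lambda>l. \<Sum>i\<in>addable l. up_weight (Suc (length l)) l i * (G l (edge l i) * f (add_box l i)))"
proof -
  obtain F where F: "F \<in> Lam_poly"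
    "\<And>l i. young l \<Longrightarrow> i \<in> addable l \<Longrightarrow> f (add_box l i) = F l (edge l i)"
    using Lam_move_box[OF assms(1), of addable add_box 1 edge]
    by (auto simp: young_add_box edge_sum_add_box)
  show ?thesis
    by (rule in_Lam_cong[OF in_Lam_weighted_sum[OF Lam_poly_mult[OF assms(2) F(1)] in_Lam_up_moment]])
       (simp add: F(2))
qed

lemma in_Lam_down_average:
  assumes "f \<in> Lam"
  shows "in_Lam (\<lambda>l. \<Sum>i\<in>removable l. down_weight (Suc (length l)) l i * f (remove_box l i))"
proof -
  obtain F where F: "F \<in> Lam_poly"
    "\<And>l i. young l \<Longrightarrow> i \<in> removable l \<Longrightarrow> f (remove_box l i) = F l (edge l i - 1)"
    using Lam_move_box[OF assms(1), of removable remove_box "-1" "\<lambda>l i. edge l i - 1"]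
    by (auto simp: young_remove_box edge_sum_remove_box)
  show ?thesis
    by (rule in_Lam_cong[OF in_Lam_weighted_sum[OF F(1) in_Lam_down_moment]]) (simp add: F(2))
qed

definition one_row :: "nat \<Rightarrow> nat list" where
  "one_row n = (if n = 0 then [] else [n])"

lemma young_one_row [simp]: "young (one_row n)"
  by (simp add: one_row_def young_def)

text \<open>Evaluation along the one-row diagrams recovers the value at the empty diagram, about which the
  intertwining relation of the down operator says nothing.\<close>
lemma Lam_one_row_poly:
  assumes "f \<in> Lam"
  shows "\<exists>p. \<forall>n. f (one_row n) = poly p (real n)"
  using assms
proof (induction rule: Lam.induct)
  case (const c)
  show ?case by (rule exI[of _ "[:c:]"]) simp
next
  case (gen k)
  have "psum k (one_row n) = poly ([:-1/2, 1:] ^ k - [:(-1/2) ^ k:]) (real n)" for n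
    unfolding psum_eq_edge_sum[OF gen young_one_row]
    by (simp add: one_row_def edge_sum_def edge_def row_def)
  then show ?case by (intro exI[of _ "[:-1/2, 1:] ^ k - [:(-1/2) ^ k:]"]) simp
next
  case (add f g)
  then obtain p q where "\<forall>n. f (one_row n) = poly p (real n)"
    "\<forall>n. g (one_row n) = poly q (real n)" by blast
  then show ?case by (intro exI[of _ "p + q"]) simp
next
  case (mult f g)
  then obtain p q where "\<forall>n. f (one_row n) = poly p (real n)"
    "\<forall>n. g (one_row n) = poly q (real n)" by blast
  then show ?case by (intro exI[of _ "p * q"]) simp
qed

lemma poly_eqI_of_nat_Suc:
  fixes p q :: "'a::{idom,ring_char_0} poly"
  assumes "\<And>n. poly p (of_nat (Suc n)) = poly q (of_nat (Suc n))"
  shows "p = q"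
proof (rule ccontr)
  assume "p \<noteq> q"
  then have "finite {x. poly (p - q) x = 0}" by (intro poly_roots_finite) simp
  moreover have "range (\<lambda>n. of_nat (Suc n)) \<subseteq> {x. poly (p - q) x = 0}" using assms by auto
  ultimately have "finite (range (\<lambda>n. of_nat (Suc n) :: 'a))" by (rule rev_finite_subset)
  then show False
    using range_inj_infinite[of "\<lambda>n. of_nat (Suc n) :: 'a"] by (simp add: inj_def del: of_nat_Suc)
qed

lemma Lam_eqI_nonempty:
  assumes f: "f \<in> Lam" and g: "g \<in> Lam" and eq: "\<And>l. young l \<Longrightarrow> l \<noteq> [] \<Longrightarrow> f l = g l"
  shows "f = g"
proof
  obtain p q where p: "\<And>n. f (one_row n) = poly p (real n)"
    and q: "\<And>n. g (one_row n) = poly q (real n)"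
    using Lam_one_row_poly[OF f] Lam_one_row_poly[OF g] by blast
  have "poly p (real (Suc n)) = poly q (real (Suc n))" for n
    using p[of "Suc n"] q[of "Suc n"] eq[OF young_one_row, of "Suc n"] by (simp add: one_row_def)
  then have "p = q" by (rule poly_eqI_of_nat_Suc)
  then have "f [] = g []" using p[of 0] q[of 0] by (simp add: one_row_def)
  then show "f l = g l" for l
    using eq[of l] Lam_not_young[OF f, of l] Lam_not_young[OF g, of l]
    by (cases "l = []"; cases "young l") auto
qed

section \<open>The down operator\<close>

text \<open>At the empty diagram, where the subtraction is truncated, the factor \<open>sum_list l\<close> vanishes.\<close>
definition Dtilde :: "(nat list \<Rightarrow> real) \<Rightarrow> nat list \<Rightarrow> real" where
  "Dtilde f l = real (sum_list l) * Dop (sum_list l - 1) f l"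

definition intertwines_down :: "((nat list \<Rightarrow> real) \<Rightarrow> nat list \<Rightarrow> real) \<Rightarrow> bool" where
  "intertwines_down T \<longleftrightarrow> (\<forall>n. \<forall>f\<in>Lam. \<forall>nu\<in>Ydiag (Suc n). Dop n f nu = T f nu / (real n + 1))"

lemma intertwines_Dtilde: "intertwines_down Dtilde"
  by (auto simp: intertwines_down_def Dtilde_def Ydiag_def add.commute)

lemma Dtilde_eq_remove_sum:
  assumes "young l"
  shows "Dtilde f l = real (sum_list l) * remove_sum (\<lambda>_. 1) (\<lambda>m. real (dimY m) * f m) l / real (dimY l)"
proof (cases "sum_list l")
  case (Suc n)
  have "Dop n f l = (\<Sum>mu | mu \<nearrow> l. pdown l mu * f mu)"
    unfolding Dop_def
    by (rule sum.mono_neutral_right[OF finite_Ydiag])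
       (use Suc in \<open>auto simp: pdown_def Ydiag_def covers_def\<close>)
  also have "\<dots> = remove_sum (\<lambda>_. 1) (\<lambda>m. real (dimY m) * f m) l / real (dimY l)"
    by (simp add: sum_covered[OF assms] remove_sum_def pdown_def covers_remove_box[OF assms]
        sum_divide_distrib)
  finally show ?thesis by (simp add: Dtilde_def Suc)
next
  case 0
  then show ?thesis unfolding Dtilde_def 0 by simp
qed

lemma Dtilde_eq_down_weight:
  assumes "young l" "length l \<le> N"
  shows "Dtilde f l = (\<Sum>i\<in>removable l. down_weight N l i * f (remove_box l i))"
proof -
  have "real (sum_list l) * real (dimY (remove_box l i)) / real (dimY l) = down_weight N l i"
    if "i \<in> removable l" for i
    using dimY_remove_box[OF assms that] dimY_pos[OF assms(1)] by simp
  then show ?thesis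
    by (simp add: Dtilde_eq_remove_sum[OF assms(1)] remove_sum_def sum_distrib_left sum_divide_distrib
        flip: mult.assoc times_divide_eq_left)
qed

lemma Dtilde_not_young: "\<not> young l \<Longrightarrow> Dtilde f l = 0"
  by (simp add: Dtilde_def Dop_def pdown_def covers_def)

lemma Dtilde_in_Lam:
  assumes "f \<in> Lam"
  shows "Dtilde f \<in> Lam"
proof (rule in_LamD)
  show "in_Lam (Dtilde f)"
    by (rule in_Lam_cong[OF in_Lam_down_average[OF assms]]) (rule Dtilde_eq_down_weight, simp_all)
qed (rule Dtilde_not_young)

lemma lin_op_Dtilde: "lin_op_Lam Dtilde"
  unfolding lin_op_Lam_def
  by (auto simp: Dtilde_in_Lam Dtilde_def Dop_def fun_eq_iff distrib_left sum.distrib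
      sum_distrib_left mult.left_commute)

lemma Dtilde_unique:
  assumes "lin_op_Lam T" "intertwines_down T" "f \<in> Lam"
  shows "T f = Dtilde f"
proof (rule Lam_eqI_nonempty)
  show "T f \<in> Lam" using assms by (simp add: lin_op_Lam_def)
  show "Dtilde f \<in> Lam" using assms(3) by (rule Dtilde_in_Lam)
  fix l :: "nat list" assume l: "young l" "l \<noteq> []"
  then obtain n where "sum_list l = Suc n"
    using Suc_sum_list_remove_box[OF l(1) removable_nonempty[OF l]] by metis
  then have "l \<in> Ydiag (Suc n)" using l by (simp add: Ydiag_def)
  then have "T f l / (real n + 1) = Dtilde f l / (real n + 1)"
    using assms(2,3) intertwines_Dtilde unfolding intertwines_down_def by metis
  then show "T f l = Dtilde f l" by simp
qed

lemma falling_Suc: "falling n (Suc m) = falling n m * (real n - real m)"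
  by (simp add: falling_def)

lemma falling_Suc_Suc: "falling (Suc n) (Suc m) = real (Suc n) * falling n m"
  by (simp add: falling_def prod.lessThan_Suc_shift del: prod.lessThan_Suc)

lemma falling_Suc_left: "falling (Suc n) m * (real n - real m + 1) = real (Suc n) * falling n m"
  using falling_Suc[of "Suc n" m] falling_Suc_Suc[of n m] by (simp add: algebra_simps)

lemma dimY_mult_FS:
  "young l \<Longrightarrow> real (dimY l) * FS mu l = falling (sum_list l) (sum_list mu) * real (dimr mu l)"
  using dimY_pos[of l] by (simp add: FS_def)

lemma Dtilde_FS: "Dtilde (FS mu) = (\<lambda>l. (psum 1 l - real (sum_list mu)) * FS mu l)"
proof
  fix l :: "nat list"
  let ?m = "sum_list mu" and ?n = "sum_list l"
  show "Dtilde (FS mu) l = (psum 1 l - real ?m) * FS mu l"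
  proof (cases "young l")
    case True
    have "real ?n * (real (dimY (remove_box l i)) * FS mu (remove_box l i))
        = falling ?n ?m * (real ?n - real ?m) * real (dimr mu (remove_box l i))"
      if i: "i \<in> removable l" for i
    proof -
      have "real ?n * falling (sum_list (remove_box l i)) ?m = falling ?n (Suc ?m)"
        unfolding Suc_sum_list_remove_box[OF True i, symmetric] falling_Suc_Suc ..
      then show ?thesis
        unfolding dimY_mult_FS[OF young_remove_box[OF True i]] falling_Suc
        by (simp flip: mult.assoc)
    qed
    then have "Dtilde (FS mu) l = falling ?n ?m
        * ((real ?n - real ?m) * remove_sum (\<lambda>_. 1) (\<lambda>rho. real (dimr mu rho)) l) / real (dimY l)"
      by (simp add: Dtilde_eq_remove_sum[OF True] remove_sum_def sum_distrib_left mult.assoc)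
    also have "(real ?n - real ?m) * remove_sum (\<lambda>_. 1) (\<lambda>rho. real (dimr mu rho)) l
        = (real ?n - real ?m) * real (dimr mu l)"
      using dimr_remove_sum_recursion[OF True, of mu] by (cases "mu = l") simp_all
    also have "falling ?n ?m * ((real ?n - real ?m) * real (dimr mu l)) / real (dimY l)
        = (real ?n - real ?m) * FS mu l"
      using True by (simp add: FS_def)
    finally show ?thesis unfolding psum_1[OF True] .
  qed (simp add: Dtilde_not_young FS_def)
qed

section \<open>The up operator\<close>

lemma Re_mult_pos_of_admissible:
  assumes "admissible z z'"
  shows "0 < Re (z * z')"
proof -
  consider "Im z \<noteq> 0" "z' = cnj z"
    | N :: int where "Im z = 0" "of_int N < Re z" "Re z < of_int N + 1"
        "of_int N < Re z'" "Re z' < of_int N + 1"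
    using assms unfolding admissible_def by blast
  then show ?thesis
  proof cases
    case 1
    then have "0 < Re z * Re z + Im z * Im z"
      by (intro add_nonneg_pos) (auto simp: zero_less_mult_iff)
    then show ?thesis using 1 by simp
  next
    case 2
    show ?thesis
    proof (cases "0 \<le> N")
      case True
      then have "0 < Re z" "0 < Re z'" using 2 by linarith+
      then show ?thesis using 2(1) by simp
    next
      case False
      then have "real_of_int N + 1 \<le> 0" by linarith
      then have "Re z < 0" "Re z' < 0" using 2 by linarith+
      then show ?thesis using 2(1) by (simp add: mult_neg_neg)
    qed
  qed
qed

definition content_weight :: "complex \<Rightarrow> complex \<Rightarrow> real \<Rightarrow> real" where
  "content_weight z z' x = Re ((z + of_real x) * (z' + of_real x))"

lemma content_weight_eq: "content_weight z z' x = Re (z * z') + Re (z + z') * x + x\<^sup>2"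
  by (simp add: content_weight_def algebra_simps power2_eq_square)

lemma skew_poch_add_box:
  assumes "young l" "i \<in> addable l"
  shows "Re (skew_poch z (add_box l i) l * skew_poch z' (add_box l i) l)
    = content_weight z z' (edge l i)"
  by (simp add: skew_poch_def boxes_add_box[OF assms] content_weight_def edge_def)

lemma skew_poch_remove_box:
  assumes "young l" "i \<in> removable l"
  shows "Re (skew_poch z l (remove_box l i) * skew_poch z' l (remove_box l i))
    = content_weight z z' (edge l i - 1)"
  using skew_poch_add_box[OF young_remove_box[OF assms] add_remove_box(1)[OF assms]]
  by (simp add: add_remove_box(2)[OF assms] edge_remove_box[OF assms])

lemma interlacing_sum_content_weight:
  "young l \<Longrightarrow> interlacing_sum (content_weight z z') l = Re (z * z') + 2 * real (sum_list l)"
  unfolding content_weight_eq[abs_def] by (rule interlacing_sum_quadratic)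

definition Utilde :: "complex \<Rightarrow> complex \<Rightarrow> (nat list \<Rightarrow> real) \<Rightarrow> nat list \<Rightarrow> real" where
  "Utilde z z' f l = (Re (z * z') + real (sum_list l)) * Uop z z' (sum_list l) f l"

definition intertwines_up :: "complex \<Rightarrow> complex \<Rightarrow> ((nat list \<Rightarrow> real) \<Rightarrow> nat list \<Rightarrow> real) \<Rightarrow> bool" where
  "intertwines_up z z' T \<longleftrightarrow>
    (\<forall>n. \<forall>f\<in>Lam. \<forall>lam\<in>Ydiag n. Uop z z' n f lam = T f lam / (Re (z * z') + real n))"

lemma Utilde_not_young: "\<not> young l \<Longrightarrow> Utilde z z' f l = 0"
  by (simp add: Utilde_def Uop_def pup_def covers_def)

context
  fixes z z' :: complex
  assumes pos: "0 < Re (z * z')"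
begin

lemma scale_nonzero: "Re (z * z') + real n \<noteq> 0"
  using pos by linarith

lemma intertwines_Utilde: "intertwines_up z z' (Utilde z z')"
  using scale_nonzero by (auto simp: intertwines_up_def Utilde_def Ydiag_def)

lemma Utilde_eq_add_sum:
  assumes "young l"
  shows "Utilde z z' f l = add_sum (content_weight z z') (\<lambda>nu. real (dimY nu) * f nu) l
    / (real (Suc (sum_list l)) * real (dimY l))"
proof -
  have "Uop z z' (sum_list l) f l = (\<Sum>nu | l \<nearrow> nu. pup z z' l nu * f nu)"
    unfolding Uop_def
    by (rule sum.mono_neutral_right[OF finite_Ydiag]) (auto simp: pup_def Ydiag_def covers_def)
  then show ?thesis
    using scale_nonzero[of "sum_list l"]
    by (simp add: Utilde_def sum_covering[OF assms] pup_def covers_add_box[OF assms]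
        skew_poch_add_box[OF assms] add_sum_def sum_distrib_left sum_divide_distrib add.commute mult.assoc
        del: times_complex.sel)
qed

lemma Utilde_eq_up_weight:
  assumes "young l" "length l < N"
  shows "Utilde z z' f l
    = (\<Sum>i\<in>addable l. up_weight N l i * (content_weight z z' (edge l i) * f (add_box l i)))"
  using dimY_pos[OF assms(1)]
  by (simp add: Utilde_eq_add_sum[OF assms(1)] add_sum_def sum_divide_distrib dimY_add_box[OF assms]
      mult_ac del: of_nat_Suc)

lemma Utilde_in_Lam:
  assumes "f \<in> Lam"
  shows "Utilde z z' f \<in> Lam"
proof (rule in_LamD)
  have "(\<lambda>l. poly [:Re (z * z'), Re (z + z'), 1:]) = (\<lambda>l. content_weight z z')"
    by (simp add: fun_eq_iff content_weight_eq power2_eq_square algebra_simps del: times_complex.sel)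
  then have "(\<lambda>l. content_weight z z') \<in> Lam_poly"
    by (metis Lam_poly_poly)
  then show "in_Lam (Utilde z z' f)"
    by (rule in_Lam_cong[OF in_Lam_up_average[OF assms]]) (rule Utilde_eq_up_weight, simp_all)
qed (rule Utilde_not_young)

lemma lin_op_Utilde: "lin_op_Lam (Utilde z z')"
  unfolding lin_op_Lam_def
  by (auto simp: Utilde_in_Lam Utilde_def Uop_def fun_eq_iff distrib_left sum.distrib sum_distrib_left
      mult.left_commute simp del: times_complex.sel)

lemma Utilde_unique:
  assumes "lin_op_Lam T" "intertwines_up z z' T" "f \<in> Lam"
  shows "T f = Utilde z z' f"
proof
  fix l
  show "T f l = Utilde z z' f l"
  proof (cases "young l")
    case True
    then have "l \<in> Ydiag (sum_list l)" by (simp add: Ydiag_def)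
    then have "Uop z z' (sum_list l) f l = T f l / (Re (z * z') + real (sum_list l))"
      using assms(2,3) by (simp add: intertwines_up_def)
    then show ?thesis
      using scale_nonzero by (simp add: Utilde_def del: times_complex.sel)
  next
    case False
    have "T f \<in> Lam" using assms by (simp add: lin_op_Lam_def)
    then show ?thesis using Lam_not_young False by (simp add: Utilde_not_young)
  qed
qed

lemma Utilde_FS_eq_remove_sum:
  assumes mu: "young mu" and l: "young l"
  shows "Utilde z z' (FS mu) l = remove_sum (content_weight z z') (\<lambda>nu. FS nu l) mu
    + (real (sum_list l) + Re (z * z') + real (sum_list mu)) * FS mu l"
proof -
  let ?w = "content_weight z z'" and ?m = "sum_list mu" and ?n = "sum_list l"
  let ?R = "remove_sum ?w (\<lambda>nu. real (dimr nu l)) mu"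
  define s where "s = real ?n + Re (z * z') + real ?m"
  define c where "c = falling (Suc ?n) ?m / real (Suc ?n)"
  have c_same: "c * (real ?n - real ?m + 1) = falling ?n ?m"
    using falling_Suc_left[of ?n ?m] by (simp add: c_def)
  have c_removed: "c = falling ?n (sum_list (remove_box mu j))" if "j \<in> removable mu" for j
    unfolding c_def Suc_sum_list_remove_box[OF mu that, symmetric] falling_Suc_Suc by simp
  have "add_sum ?w (\<lambda>nu. real (dimY nu) * FS mu nu) l
      = falling (Suc ?n) ?m * add_sum ?w (\<lambda>nu. real (dimr mu nu)) l"
    using l by (simp add: add_sum_def dimY_mult_FS young_add_box sum_list_add_box
        sum_distrib_left mult.left_commute)
  then have "Utilde z z' (FS mu) l = c * add_sum ?w (\<lambda>nu. real (dimr mu nu)) l / real (dimY l)"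
    by (simp add: Utilde_eq_add_sum[OF l] c_def del: of_nat_Suc)
  also have "add_sum ?w (\<lambda>nu. real (dimr mu nu)) l = ?R + (real ?n - real ?m + 1) * s * real (dimr mu l)"
    using add_sum_dimr[OF interlacing_sum_content_weight mu l] by (simp only: s_def add_ac)
  also have "c * \<dots> / real (dimY l)
      = c * ?R / real (dimY l) + (c * (real ?n - real ?m + 1)) * s * real (dimr mu l) / real (dimY l)"
    by (simp only: distrib_left[of c ?R] add_divide_distrib mult.assoc)
  also have "c * ?R / real (dimY l) = remove_sum ?w (\<lambda>nu. FS nu l) mu"
    unfolding remove_sum_def sum_distrib_left sum_divide_distrib
    by (rule sum.cong) (use l c_removed in \<open>simp_all add: FS_def\<close>)
  also have "(c * (real ?n - real ?m + 1)) * s * real (dimr mu l) / real (dimY l) = s * FS mu l"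
    unfolding c_same using l by (simp add: FS_def)
  finally show ?thesis by (simp only: s_def)
qed

lemma Utilde_FS:
  assumes mu: "young mu"
  shows "Utilde z z' (FS mu) = (\<lambda>l.
      (\<Sum>mb\<in>{mb. mb \<nearrow> mu}. Re (skew_poch z mu mb * skew_poch z' mu mb) * FS mb l)
      + (psum 1 l + Re (z * z') + real (sum_list mu)) * FS mu l)"
proof
  fix l :: "nat list"
  have covered: "(\<Sum>mb\<in>{mb. mb \<nearrow> mu}. Re (skew_poch z mu mb * skew_poch z' mu mb) * FS mb l)
      = remove_sum (content_weight z z') (\<lambda>nu. FS nu l) mu"
    unfolding sum_covered[OF mu] remove_sum_def
    by (rule sum.cong) (simp_all only: skew_poch_remove_box[OF mu])
  show "Utilde z z' (FS mu) l
      = (\<Sum>mb\<in>{mb. mb \<nearrow> mu}. Re (skew_poch z mu mb * skew_poch z' mu mb) * FS mb l)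
        + (psum 1 l + Re (z * z') + real (sum_list mu)) * FS mu l"
  proof (cases "young l")
    case True
    then show ?thesis
      unfolding covered psum_1[OF True] by (rule Utilde_FS_eq_remove_sum[OF mu])
  next
    case False
    then show ?thesis
      unfolding covered by (simp add: Utilde_not_young remove_sum_def FS_def)
  qed
qed

end

theorem theorem4p1:
  fixes z z' :: complex
  assumes "admissible z z'"
  shows
   "(\<exists>Dt. lin_op_Lam Dt \<and>
        (\<forall>n. \<forall>f\<in>Lam. \<forall>nu\<in>Ydiag (Suc n). Dop n f nu = Dt f nu / (real n + 1)) \<and>
        (\<forall>D'. lin_op_Lam D' \<and>
            (\<forall>n. \<forall>f\<in>Lam. \<forall>nu\<in>Ydiag (Suc n). Dop n f nu = D' f nu / (real n + 1))
            \<longrightarrow> (\<forall>f\<in>Lam. D' f = Dt f)) \<and>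
        (\<forall>mu. young mu \<longrightarrow>
            Dt (FS mu) = (\<lambda>l. (psum 1 l - real (sum_list mu)) * FS mu l)))
    \<and>
    (\<exists>Ut. lin_op_Lam Ut \<and>
        (\<forall>n. \<forall>f\<in>Lam. \<forall>lam\<in>Ydiag n.
            Uop z z' n f lam = Ut f lam / (Re (z * z') + real n)) \<and>
        (\<forall>U'. lin_op_Lam U' \<and>
            (\<forall>n. \<forall>f\<in>Lam. \<forall>lam\<in>Ydiag n.
               Uop z z' n f lam = U' f lam / (Re (z * z') + real n))
            \<longrightarrow> (\<forall>f\<in>Lam. U' f = Ut f)) \<and>
        (\<forall>mu. young mu \<longrightarrow>
            Ut (FS mu) = (\<lambda>l. (\<Sum>mb\<in>{mb. mb \<nearrow> mu}.
                  Re (skew_poch z mu mb * skew_poch z' mu mb) * FS mb l)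
              + (psum 1 l + Re (z * z') + real (sum_list mu)) * FS mu l)))"
  unfolding intertwines_down_def[symmetric] intertwines_up_def[symmetric]
proof (intro conjI exI)
  note pos = Re_mult_pos_of_admissible[OF assms]
  show "lin_op_Lam Dtilde" by (rule lin_op_Dtilde)
  show "intertwines_down Dtilde" by (rule intertwines_Dtilde)
  show "\<forall>D'. lin_op_Lam D' \<and> intertwines_down D' \<longrightarrow> (\<forall>f\<in>Lam. D' f = Dtilde f)"
    using Dtilde_unique by blast
  show "\<forall>mu. young mu \<longrightarrow> Dtilde (FS mu) = (\<lambda>l. (psum 1 l - real (sum_list mu)) * FS mu l)"
    using Dtilde_FS by blast
  show "lin_op_Lam (Utilde z z')" by (rule lin_op_Utilde[OF pos])
  show "intertwines_up z z' (Utilde z z')" by (rule intertwines_Utilde[OF pos])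
  show "\<forall>U'. lin_op_Lam U' \<and> intertwines_up z z' U' \<longrightarrow> (\<forall>f\<in>Lam. U' f = Utilde z z' f)"
    using Utilde_unique[OF pos] by blast
  show "\<forall>mu. young mu \<longrightarrow> Utilde z z' (FS mu) = (\<lambda>l. (\<Sum>mb\<in>{mb. mb \<nearrow> mu}.
      Re (skew_poch z mu mb * skew_poch z' mu mb) * FS mb l)
      + (psum 1 l + Re (z * z') + real (sum_list mu)) * FS mu l)"
    using Utilde_FS[OF pos] by blast
qed

end
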